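(* Let $s\in\mathbb{R}$ and $f,g\in\mathcal{Z}^s(\mathbb{S}^2)$. For every $\varepsilon>0$ there is a constant $C_\varepsilon$ (depending only on $\varepsilon$) such that for all dyadic $N\ge M\geq 1$, $$\big\|P_N(e^{it\Delta_{\mathbb{S}^2}}f)\,P_M(e^{it\Delta_{\mathbb{S}^2}}g)\big\|_{L^2_{x,t}(\mathbb{S}^2\times[0,2\pi])}\le C_\varepsilon M^\varepsilon\|P_Nf\|_{L^2(\mathbb{S}^2)}\|P_Mg\|_{L^2(\mathbb{S}^2)}.$$
   Context: $Y_n(\theta)=\sqrt{2n+1}\,P_n(\cos\theta)$ are the zonal harmonics on $\mathbb{S}^2$ ($P_n$ Legendre polynomials, $\theta$ the angle from the north pole), $\Delta_{\mathbb{S}^2}Y_n=-n(n+1)Y_n$. $\mathcal{Z}^s(\mathbb{S}^2)=\{f\in H^s(\mathbb{S}^2):f=\sum_na_nY_n\}$. $P_N$ is the sharp Littlewood–Paley projection $P_N(\sum_na_nY_n)=\sum_{N\le n<2N}a_nY_n$. *)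

theory Defs
  imports "HOL-Analysis.Analysis" "HOL-Computational_Algebra.Polynomial"
begin

text \<open>Rodrigues' formula: \<open>P\<^sub>n = 1 / (2\<^sup>n n!) (d/dx)\<^sup>n (x\<^sup>2 - 1)\<^sup>n\<close>.\<close>
definition legendre_poly :: "nat \<Rightarrow> real poly" where
  "legendre_poly n = smult (1 / (2 ^ n * fact n)) ((pderiv ^^ n) ([:-1, 0, 1:] ^ n))"

definition zonal_harmonic :: "nat \<Rightarrow> real \<Rightarrow> real" where
  "zonal_harmonic n \<theta> = sqrt (2 * real n + 1) * poly (legendre_poly n) (cos \<theta>)"

definition spherical_point :: "real \<times> real \<Rightarrow> real ^ 3" where
  "spherical_point = (\<lambda>(\<theta>, \<phi>). vector [sin \<theta> * cos \<phi>, sin \<theta> * sin \<phi>, cos \<theta>])"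

text \<open>The (unnormalised, total mass \<open>4\<pi>\<close>) area measure \<open>sin \<theta> d\<theta> d\<phi>\<close> on the unit sphere of \<open>\<real>\<^sup>3\<close>.\<close>
definition sphere_measure :: "(real ^ 3) measure" where
  "sphere_measure =
     distr (density lborel (\<lambda>(\<theta>, \<phi>). ennreal (indicator ({0..pi} \<times> {0..2 * pi}) (\<theta>, \<phi>) * sin \<theta>)))
       (restrict_space borel (sphere 0 1)) spherical_point"

definition polar_angle :: "real ^ 3 \<Rightarrow> real" where
  "polar_angle x = arccos (x $ 3)"

text \<open>
  A zonal distribution \<open>f = \<Sum>\<^sub>n a\<^sub>n Y\<^sub>n\<close> is represented by its coefficient sequence \<open>a\<close>; for \<open>s < 0\<close>
  it need not be a function. The weight is that of \<open>(1 - \<Delta>)\<^sup>s\<close>, as \<open>\<Delta> Y\<^sub>n = - n (n + 1) Y\<^sub>n\<close>.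
\<close>
definition laplace_eigenvalue :: "nat \<Rightarrow> real" where
  "laplace_eigenvalue n = - (real n * (real n + 1))"

definition zonal_sobolev :: "real \<Rightarrow> (nat \<Rightarrow> complex) set" where
  "zonal_sobolev s = {a. summable (\<lambda>n. (1 - laplace_eigenvalue n) powr s * (cmod (a n))\<^sup>2)}"

definition schroedinger :: "real \<Rightarrow> (nat \<Rightarrow> complex) \<Rightarrow> (nat \<Rightarrow> complex)" where
  "schroedinger t a = (\<lambda>n. exp (\<i> * of_real (t * laplace_eigenvalue n)) * a n)"

definition LP_proj :: "nat \<Rightarrow> (nat \<Rightarrow> complex) \<Rightarrow> (nat \<Rightarrow> complex)" where
  "LP_proj N a = (\<lambda>n. if N \<le> n \<and> n < 2 * N then a n else 0)"

text \<open>Pointwise synthesis, meaningful if the series converges, in particular for finitely supported \<open>a\<close>.\<close>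
definition zonal_fun :: "(nat \<Rightarrow> complex) \<Rightarrow> real ^ 3 \<Rightarrow> complex" where
  "zonal_fun a x = (\<Sum>n. a n * of_real (zonal_harmonic n (polar_angle x)))"

text \<open>Only meaningful for square-integrable \<open>h\<close> (the integral of a non-integrable function is 0).\<close>
definition L2_norm :: "'a measure \<Rightarrow> ('a \<Rightarrow> complex) \<Rightarrow> real" where
  "L2_norm M h = sqrt (\<integral>x. (cmod (h x))\<^sup>2 \<partial>M)"

definition dyadic :: "nat \<Rightarrow> bool" where
  "dyadic N \<longleftrightarrow> (\<exists>k. N = 2 ^ k)"

end

theory Submission
  imports Defs
begin

text \<open>
  The phases \<open>n (n + 1) + m (m + 1)\<close> are integers, so in \<open>L\<^sup>2\<close> of the time interval only products
  \<open>Y\<^sub>n Y\<^sub>m\<close> with the same phase interact. Hence the square of the left-hand side is at most a constant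
  times \<open>R J \<parallel>P\<^sub>N f\<parallel>\<^sup>2 \<parallel>P\<^sub>M g\<parallel>\<^sup>2\<close>, where \<open>R\<close> bounds the number of pairs \<open>(n, m)\<close> with a given phase \<open>k\<close> and
  \<open>J\<close> bounds \<open>\<integral> Y\<^sub>n\<^sup>2 Y\<^sub>m\<^sup>2\<close>.

  For \<open>R\<close>: if \<open>N > 2 M\<^sup>2\<close>, the values \<open>n (n + 1)\<close> are further apart than the range of \<open>m (m + 1)\<close>, so
  \<open>R = 1\<close>. Otherwise \<open>(2 n + 1)\<^sup>2 + (2 m + 1)\<^sup>2 = 4 k + 2\<close> is at most a power of \<open>M\<close>, and the number of its
  representations as a sum of two squares is at most the square of its number of divisors.

  For \<open>J\<close>: Bernstein's inequality gives \<open>Y\<^sub>n\<^sup>2 \<le> 4 / sin \<theta>\<close>. Interpolating it for \<open>Y\<^sub>m\<close> with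
  \<open>Y\<^sub>m\<^sup>2 \<le> 2 m + 1\<close> makes \<open>Y\<^sub>n\<^sup>2 Y\<^sub>m\<^sup>2\<close> integrable at the poles at the cost of a factor \<open>M\<^sup>\<epsilon>\<close>.
\<close>

section \<open>Sums of two squares and resonant pairs\<close>

text \<open>A divisor is determined by its multiplicities at the primes dividing \<open>n\<close>,
  each at most that of \<open>n\<close>.\<close>

lemma card_divisors_le_prod:
  fixes n :: nat
  assumes "n > 0"
  shows "card {d. d dvd n} \<le> (\<Prod>p\<in>prime_factors n. Suc (multiplicity p n))"
proof -
  define f where "f = (\<lambda>d. restrict (\<lambda>p. multiplicity p d) (prime_factors n))"
  have "inj_on f {d. d dvd n}"
  proof (rule inj_onI)
    fix d e assume de: "d \<in> {d. d dvd n}" "e \<in> {d. d dvd n}" "f d = f e"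
    then have pos: "d > 0" "e > 0" using assms by (auto intro: dvd_pos_nat)
    show "d = e"
    proof (rule multiplicity_eq_nat[OF pos])
      fix p :: nat assume p: "prime p"
      show "multiplicity p d = multiplicity p e"
      proof (cases "p \<in> prime_factors n")
        case True
        then show ?thesis using de(3) unfolding f_def by (metis restrict_apply')
      next
        case False
        then have "\<not> p dvd n" using p assms by (simp add: prime_factors_dvd)
        then have "\<not> p dvd d" "\<not> p dvd e" using de dvd_trans by auto
        then show ?thesis by (simp add: not_dvd_imp_multiplicity_0)
      qed
    qed
  qed
  moreover have "f ` {d. d dvd n} \<subseteq> PiE (prime_factors n) (\<lambda>p. {..multiplicity p n})"
    unfolding f_def using assms by (auto intro!: dvd_imp_multiplicity_le)
  moreover have "finite (PiE (prime_factors n) (\<lambda>p. {..multiplicity p n}))"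
    by (intro finite_PiE) auto
  ultimately have "card {d. d dvd n} \<le> card (PiE (prime_factors n) (\<lambda>p. {..multiplicity p n}))"
    by (rule card_inj_on_le)
  also have "\<dots> = (\<Prod>p\<in>prime_factors n. Suc (multiplicity p n))"
    by (simp add: card_PiE)
  finally show ?thesis .
qed

text \<open>For the small primes in the divisor bound, with \<open>q = p powr \<epsilon>\<close>:
  Bernoulli's inequality bounds \<open>q ^ a\<close> below by \<open>1 + a * x\<close>, which loses
  only a constant against \<open>a + 1\<close>.\<close>

lemma Suc_le_const_mult_power:
  fixes q x :: real
  assumes "x > 0" "q \<ge> 1 + x"
  shows "real (Suc a) \<le> (1 + 1 / x) * q ^ a"
proof -
  have "real (Suc a) \<le> (1 + 1 / x) * (1 + real a * x)"
    using assms by (simp add: field_simps)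
  also have "1 + real a * x \<le> (1 + x) ^ a"
    using Bernoulli_inequality[of x a] assms by simp
  also have "(1 + x) ^ a \<le> q ^ a"
    using assms by (intro power_mono) auto
  finally show ?thesis using assms by (simp add: mult_left_mono)
qed

text \<open>The factor \<open>a + 1\<close> of a prime power \<open>p ^ a\<close> is compared with
  \<open>p powr (\<epsilon> * a)\<close>. Once \<open>p powr \<epsilon> \<ge> 2\<close>, it is
  smaller because \<open>a + 1 \<le> 2 ^ a\<close>. The remaining primes lie below a bound
  \<open>B\<close> depending only on \<open>\<epsilon>\<close>, and each costs at most a constant
  \<open>K\<close>.\<close>

lemma divisor_bound:
  fixes \<epsilon> :: real
  assumes "\<epsilon> > 0"
  shows "\<exists>C\<ge>1. \<forall>n>0. real (card {d. d dvd n}) \<le> C * real n powr \<epsilon>"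
proof -
  \<comment> \<open>Chosen so that \<open>p powr \<epsilon> \<ge> 1 + x\<close> for every prime, the
    worst case being \<open>p = 2\<close>.\<close>
  define x where "x = 2 powr \<epsilon> - 1"
  have x: "x > 0" using assms by (simp add: x_def)
  define K where "K = 1 + 1 / x"
  have K: "K \<ge> 1" using x by (simp add: K_def)
  \<comment> \<open>From \<open>B\<close> on, \<open>p powr \<epsilon> \<ge> 2\<close>.\<close>
  define B where "B = nat \<lceil>2 powr (1 / \<epsilon>)\<rceil>"
  have "real (card {d. d dvd n}) \<le> K ^ B * real n powr \<epsilon>" if n: "n > 0" for n
  proof -
    define k where "k = (\<lambda>p. if p < B then K else 1)"
    have factor: "real (Suc (multiplicity p n)) \<le> k p * (real p powr \<epsilon>) ^ multiplicity p n"
      if "p \<in> prime_factors n" for p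
    proof -
      have p: "p \<ge> 2" using that in_prime_factors_imp_prime prime_ge_2_nat by blast
      show ?thesis
      proof (cases "p < B")
        case True
        have "real p powr \<epsilon> \<ge> 1 + x" unfolding x_def using p assms by (simp add: powr_mono2)
        then show ?thesis using Suc_le_const_mult_power[OF x] True by (simp add: k_def K_def)
      next
        case False
        then have "real p \<ge> 2 powr (1 / \<epsilon>)" unfolding B_def by linarith
        then have "(2 powr (1 / \<epsilon>)) powr \<epsilon> \<le> real p powr \<epsilon>"
          using assms by (intro powr_mono2) auto
        then have "2 \<le> real p powr \<epsilon>" using assms by (simp add: powr_powr)
        then have "2 ^ multiplicity p n \<le> (real p powr \<epsilon>) ^ multiplicity p n"
          by (intro power_mono) auto
        moreover have "real (Suc a) \<le> 2 ^ a" for a :: nat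
          using less_exp[of a] by (metis Suc_leI of_nat_le_iff of_nat_numeral of_nat_power)
        ultimately show ?thesis using False by (simp add: k_def) (meson order_trans)
      qed
    qed
    have "real (card {d. d dvd n}) \<le> (\<Prod>p\<in>prime_factors n. real (Suc (multiplicity p n)))"
      using card_divisors_le_prod[OF n] by (metis of_nat_le_iff of_nat_prod)
    also have "\<dots> \<le> (\<Prod>p\<in>prime_factors n. k p * (real p powr \<epsilon>) ^ multiplicity p n)"
      using factor by (intro prod_mono) auto
    also have "\<dots> = (\<Prod>p\<in>prime_factors n. k p) * (\<Prod>p\<in>prime_factors n. (real p powr \<epsilon>) ^ multiplicity p n)"
      by (simp add: prod.distrib)
    also have "(\<Prod>p\<in>prime_factors n. (real p powr \<epsilon>) ^ multiplicity p n) = real n powr \<epsilon>"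
    proof -
      have "(\<Prod>p\<in>prime_factors n. (real p powr \<epsilon>) ^ multiplicity p n)
          = (\<Prod>p\<in>prime_factors n. (real p ^ multiplicity p n) powr \<epsilon>)"
      proof (intro prod.cong refl)
        fix p assume "p \<in> prime_factors n"
        then have "real p > 0" using in_prime_factors_imp_prime prime_gt_0_nat by auto
        then show "(real p powr \<epsilon>) ^ multiplicity p n = (real p ^ multiplicity p n) powr \<epsilon>"
          by (simp add: powr_realpow[symmetric] powr_powr mult.commute)
      qed
      also have "\<dots> = (\<Prod>p\<in>prime_factors n. real p ^ multiplicity p n) powr \<epsilon>"
        by (simp add: prod_powr_distrib)
      also have "(\<Prod>p\<in>prime_factors n. real p ^ multiplicity p n) = real n"
        using prime_factorization_nat[OF n] by (metis (no_types, lifting) of_nat_power of_nat_prod prod.cong)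
      finally show ?thesis .
    qed
    also have "(\<Prod>p\<in>prime_factors n. k p) \<le> K ^ B"
    proof -
      have "(\<Prod>p\<in>prime_factors n. k p) = (\<Prod>p\<in>prime_factors n \<inter> {..<B}. K)"
        unfolding k_def by (subst prod.inter_restrict) (auto intro!: prod.cong)
      also have "\<dots> = K ^ card (prime_factors n \<inter> {..<B})" by simp
      also have "\<dots> \<le> K ^ B"
        using K card_mono[of "{..<B}" "prime_factors n \<inter> {..<B}"] by (intro power_increasing) auto
      finally show ?thesis .
    qed
    finally show ?thesis by (simp add: mult_right_mono)
  qed
  moreover have "K ^ B \<ge> 1" using K by (simp add: one_le_power)
  ultimately show ?thesis by blast
qed

section \<open>Representations as a sum of two odd squares\<close>

text \<open>The entries stand for \<open>2 * n + 1\<close> and \<open>2 * m + 1\<close>. Oddness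
  makes them positive and keeps the sum from being divisible by 4.\<close>

definition odd_two_squares :: "nat \<Rightarrow> (nat \<times> nat) set" where
  "odd_two_squares n = {(x, y). odd x \<and> odd y \<and> x\<^sup>2 + y\<^sup>2 = n}"

definition primitive_odd_two_squares :: "nat \<Rightarrow> (nat \<times> nat) set" where
  "primitive_odd_two_squares n = {(x, y). odd x \<and> odd y \<and> coprime x y \<and> x\<^sup>2 + y\<^sup>2 = n}"

lemma finite_odd_two_squares: "finite (odd_two_squares n)"
proof (rule finite_subset)
  show "odd_two_squares n \<subseteq> {..n} \<times> {..n}"
    unfolding odd_two_squares_def
    by (auto simp: power2_eq_square) (metis le_add1 le_add2 le_square le_trans)+
qed auto

text \<open>A common divisor of \<open>n\<close> and \<open>x\<close> would divide
  \<open>y\<^sup>2\<close>.\<close>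

lemma primitive_coprime:
  fixes x y n :: int
  assumes "coprime x y" "x\<^sup>2 + y\<^sup>2 = n"
  shows "coprime n x" "coprime n y"
  using assms by (auto simp: power2_eq_square coprime_commute)
    (metis coprime_commute coprime_mult_left_iff gcd_add_mult coprime_iff_gcd_eq_1 add.commute gcd.commute)+

lemma odd_two_squares_not_4_dvd:
  fixes x y :: int
  assumes "odd x" "odd y" 
  shows "\<not> 4 dvd x\<^sup>2 + y\<^sup>2"
proof -
  obtain a b where "x = 2 * a + 1" "y = 2 * b + 1" using assms by (auto elim!: oddE)
  then have "x\<^sup>2 + y\<^sup>2 = 4 * (a\<^sup>2 + a + b\<^sup>2 + b) + 2" by (simp add: power2_eq_square algebra_simps)
  then show ?thesis by presburger
qed

text \<open>After division by \<open>gcd n A\<close>, what is left of \<open>n\<close> is coprime to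
  what is left of \<open>A\<close>, so it must divide \<open>B\<close>. This splits \<open>n\<close>
  between the two factors of a difference of squares.\<close>

lemma gcd_complement_dvd:
  fixes n A B :: int
  assumes "n \<noteq> 0" "n dvd A * B"
  shows "n div gcd n A dvd B"
proof -
  have "coprime (n div gcd n A) (A div gcd n A)" using assms by (intro div_gcd_coprime) auto
  moreover have "n div gcd n A dvd (A div gcd n A) * B"
  proof -
    have "gcd n A * (n div gcd n A) dvd gcd n A * ((A div gcd n A) * B)"
      using assms by (simp add: mult.assoc[symmetric])
    moreover have "gcd n A \<noteq> 0" using assms by simp
    ultimately show ?thesis by (simp only: dvd_mult_cancel_left) simp
  qed
  ultimately show ?thesis using coprime_dvd_mult_right_iff by blast
qed

text \<open>
  Modulo \<open>n\<close> the quotients \<open>x / y\<close> are square roots of \<open>-1\<close>; relative to a fixed one, such a root is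
  determined by the part of \<open>n\<close> modulo which the two agree (on the complementary part they are
  opposite).
\<close>
lemma primitive_two_squares_unique:
  fixes x y x' y' u v n :: int
  assumes pos: "x > 0" "y > 0" "x' > 0" "y' > 0"
    and odd: "odd u" "odd v"
    and cop: "coprime x y" "coprime x' y'" "coprime u v"
    and eq: "x\<^sup>2 + y\<^sup>2 = n" "x'\<^sup>2 + y'\<^sup>2 = n" "u\<^sup>2 + v\<^sup>2 = n"
    and gcd: "gcd n (x * v - u * y) = gcd n (x' * v - u * y')"
  shows "x = x'" "y = y'"
proof -
  \<comment> \<open>Modulo \<open>d\<close> the quotients \<open>x / y\<close> and
    \<open>u / v\<close> agree; modulo \<open>e\<close> they are opposite. Equality of the gcds
    makes \<open>d\<close> and \<open>e\<close> the same for both representations.\<close>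
  define d where "d = gcd n (x * v - u * y)"
  define e where "e = n div d"
  have n: "n > 0" using eq(1) pos by (metis add_pos_pos zero_less_power)
  have n_de: "n = d * e" by (simp add: d_def e_def)
  have prod: "n dvd (a * v - u * b) * (a * v + u * b)" if "a\<^sup>2 + b\<^sup>2 = n" for a b
  proof -
    have b: "b\<^sup>2 = n - a\<^sup>2" and v: "v\<^sup>2 = n - u\<^sup>2" using that eq(3) by simp_all
    have "(a * v - u * b) * (a * v + u * b) = a\<^sup>2 * v\<^sup>2 - u\<^sup>2 * b\<^sup>2"
      by (simp add: power2_eq_square algebra_simps)
    also have "\<dots> = n * (a\<^sup>2 - u\<^sup>2)"
      unfolding b v by (simp add: algebra_simps)
    finally show ?thesis by simp
  qed
  have d1: "d dvd x * v - u * y" "d dvd x' * v - u * y'"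
    unfolding d_def by (simp, subst gcd, simp)
  have e1: "e dvd x * v + u * y"
    unfolding e_def d_def using n prod[OF eq(1)] by (intro gcd_complement_dvd) auto
  have e2: "e dvd x' * v + u * y'"
    unfolding e_def d_def gcd using n prod[OF eq(2)] by (intro gcd_complement_dvd) auto
  have cnv: "coprime n v" using primitive_coprime[OF cop(3) eq(3)] by simp
  have cnx: "coprime n x" using primitive_coprime[OF cop(1) eq(1)] by simp
  \<comment> \<open>A common factor divides \<open>2 * x * v\<close>, hence 2, because
    \<open>x\<close> and \<open>v\<close> are coprime to \<open>n\<close>. It cannot be 2, since 4
    does not divide \<open>n\<close>.\<close>
  have "coprime d e"
  proof -
    define h where "h = gcd d e"
    have "h dvd (x * v - u * y) + (x * v + u * y)"
      using d1(1) e1 unfolding h_def by (meson dvd_add dvd_trans gcd_dvd1 gcd_dvd2)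
    then have "h dvd 2 * (x * v)" by (simp add: algebra_simps)
    moreover have "h dvd n" unfolding h_def n_de by simp
    then have "coprime h (x * v)"
      using cnv cnx by (meson coprime_divisors coprime_mult_right_iff dvd_refl)
    ultimately have "h dvd 2" by (simp add: coprime_dvd_mult_left_iff)
    moreover have "h \<ge> 0" by (simp add: h_def)
    moreover have "h \<noteq> 2"
    proof
      assume "h = 2"
      then have "2 dvd d" "2 dvd e" unfolding h_def by (metis gcd_dvd1, metis gcd_dvd2)
      then have "2 * 2 dvd n" unfolding n_de by (rule mult_dvd_mono)
      then show False using odd_two_squares_not_4_dvd[OF odd] eq(3) by simp
    qed
    moreover have "h \<le> 2" using \<open>h dvd 2\<close> by (simp add: zdvd_imp_le)
    moreover have "h \<noteq> 0" using \<open>h dvd 2\<close> by auto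
    ultimately have "h = 1" by linarith
    then show ?thesis by (simp add: h_def coprime_iff_gcd_eq_1)
  qed
  \<comment> \<open>The determinant of the two representations vanishes modulo \<open>d\<close> and
    modulo \<open>e\<close>, hence modulo \<open>n\<close>. Being smaller than \<open>n\<close> in
    absolute value, it is 0, so that the two pairs are proportional.\<close>
  define D where "D = x * y' - x' * y"
  have "d dvd y' * (x * v - u * y) - y * (x' * v - u * y')" using d1 by (meson dvd_diff dvd_mult)
  moreover have "e dvd y' * (x * v + u * y) - y * (x' * v + u * y')" using e1 e2 by (meson dvd_diff dvd_mult)
  ultimately have "d dvd v * D" "e dvd v * D" by (simp_all add: D_def algebra_simps)
  then have "n dvd v * D" unfolding n_de using \<open>coprime d e\<close> by (simp add: divides_mult)
  then have nD: "n dvd D" using cnv coprime_dvd_mult_right_iff by blast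
  have lt: "a * b' < n" if "a > 0" "b > 0" "a' > 0" "b' > 0" "a\<^sup>2 + b\<^sup>2 = n" "a'\<^sup>2 + b'\<^sup>2 = n" for a b a' b' :: int
  proof -
    have "0 < b\<^sup>2" "0 < a'\<^sup>2" using that by simp_all
    then have "a\<^sup>2 < n" "b'\<^sup>2 < n" using that(5,6) by linarith+
    moreover have "0 \<le> (a - b')\<^sup>2" by simp
    then have "2 * (a * b') \<le> a\<^sup>2 + b'\<^sup>2" by (simp add: power2_eq_square algebra_simps)
    ultimately show ?thesis by linarith
  qed
  have "x * y' < n" "x' * y < n" using lt pos eq by blast+
  moreover have "x * y' > 0" "x' * y > 0" using pos by auto
  ultimately have "\<bar>D\<bar> < n" by (simp add: D_def abs_if)
  then have "D = 0" using nD by (metis abs_ge_self dvd_imp_le_int leD order_less_le_trans)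
  then have "x * y' = x' * y" by (simp add: D_def)
  then show "x = x'" "y = y'"
    using coprime_crossproduct_int[of x y x' y'] cop pos by (simp_all add: mult.commute)
qed

text \<open>With one representation \<open>(u, v)\<close> fixed, any other one is recovered from the
  divisor \<open>gcd n (x * v - u * y)\<close> of \<open>n\<close>.\<close>

lemma card_primitive_odd_two_squares:
  assumes "n > 0"
  shows "card (primitive_odd_two_squares n) \<le> card {d. d dvd n}"
proof (cases "primitive_odd_two_squares n = {}")
  case False
  then obtain u v where uv: "odd u" "odd v" "coprime u v" "u\<^sup>2 + v\<^sup>2 = n"
    unfolding primitive_odd_two_squares_def by auto
  define f where "f = (\<lambda>(x, y). nat (gcd (int n) (int x * int v - int u * int y)))"
  show ?thesis
  proof (rule card_inj_on_le)
    show "inj_on f (primitive_odd_two_squares n)"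
    proof (rule inj_onI, clarify)
      fix x y x' y'
      assume "(x, y) \<in> primitive_odd_two_squares n" "(x', y') \<in> primitive_odd_two_squares n"
        and f: "f (x, y) = f (x', y')"
      then have *: "odd x" "odd y" "coprime x y" "x\<^sup>2 + y\<^sup>2 = n"
        "odd x'" "odd y'" "coprime x' y'" "x'\<^sup>2 + y'\<^sup>2 = n"
        unfolding primitive_odd_two_squares_def by auto
      have "gcd (int n) (int x * int v - int u * int y) = gcd (int n) (int x' * int v - int u * int y')"
        using f by (simp only: f_def case_prod_conv eq_nat_nat_iff gcd_ge_0_int)
      moreover have "int x > 0" "int y > 0" "int x' > 0" "int y' > 0"
        using * by (auto intro!: Nat.gr0I)
      moreover have "(int x)\<^sup>2 + (int y)\<^sup>2 = int n" "(int x')\<^sup>2 + (int y')\<^sup>2 = int n"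
          "(int u)\<^sup>2 + (int v)\<^sup>2 = int n"
        using *(4,8) uv(4) by (metis of_nat_add of_nat_power)+
      ultimately have "int x = int x'" "int y = int y'"
        using primitive_two_squares_unique[of "int x" "int y" "int x'" "int y'" "int u" "int v" "int n"]
          * uv by simp_all
      then show "x = x' \<and> y = y'" by simp
    qed
    show "f ` primitive_odd_two_squares n \<subseteq> {d. d dvd n}"
      unfolding f_def using assms by (auto simp: nat_dvd_iff)
  qed (use assms in auto)
qed simp

text \<open>Dividing by \<open>g = gcd x y\<close> leaves a primitive representation of
  \<open>n div g\<^sup>2\<close>. Both the number of possible \<open>g\<close> and the number of
  primitive representations for each \<open>g\<close> are at most the number of divisors of
  \<open>n\<close>.\<close>

lemma card_odd_two_squares:
  assumes "n > 0"
  shows "card (odd_two_squares n) \<le> (card {d. d dvd n})\<^sup>2"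
proof -
  define G where "G = {g. g\<^sup>2 dvd n}"
  have G: "G \<subseteq> {d. d dvd n}" unfolding G_def by (auto simp: power2_eq_square dest: dvd_mult_left)
  have fin: "finite {d. d dvd n}" using assms by simp
  have finG: "finite G" using G fin finite_subset by blast
  define P where "P = (\<lambda>g. primitive_odd_two_squares (n div g\<^sup>2))"
  have finP: "finite (P g)" for g
    unfolding P_def
    by (rule finite_subset[OF _ finite_odd_two_squares])
      (auto simp: primitive_odd_two_squares_def odd_two_squares_def)
  have "odd_two_squares n \<subseteq> (\<Union>g\<in>G. (\<lambda>(x, y). (g * x, g * y)) ` P g)"
  proof clarify
    fix x y assume "(x, y) \<in> odd_two_squares n"
    then have xy: "odd x" "odd y" "x\<^sup>2 + y\<^sup>2 = n" unfolding odd_two_squares_def by auto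
    define g where "g = gcd x y"
    have "x > 0" using xy by (auto intro!: Nat.gr0I)
    then have g: "g > 0" by (simp add: g_def)
    obtain x' y' where x: "x = x' * g" and y: "y = y' * g" and cop: "coprime x' y'"
      using gcd_coprime_exists[of x y] g unfolding g_def by blast
    have n: "n = g\<^sup>2 * (x'\<^sup>2 + y'\<^sup>2)"
      using xy(3) unfolding x y by (simp add: power_mult_distrib algebra_simps)
    then have "n div g\<^sup>2 = x'\<^sup>2 + y'\<^sup>2" using g by simp
    then have "(x', y') \<in> P g"
      using xy cop unfolding P_def primitive_odd_two_squares_def x y by auto
    moreover have "g \<in> G" using n by (simp add: G_def)
    ultimately show "(x, y) \<in> (\<Union>g\<in>G. (\<lambda>(x, y). (g * x, g * y)) ` P g)"
      unfolding x y by (auto simp: mult.commute intro!: bexI[of _ g] image_eqI[of _ _ "(x', y')"])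
  qed
  then have "card (odd_two_squares n) \<le> card (\<Union>g\<in>G. (\<lambda>(x, y). (g * x, g * y)) ` P g)"
    using finG finP by (intro card_mono) auto
  also have "\<dots> \<le> (\<Sum>g\<in>G. card ((\<lambda>(x, y). (g * x, g * y)) ` P g))"
    by (rule card_UN_le[OF finG])
  also have "\<dots> \<le> (\<Sum>g\<in>G. card {d. d dvd n})"
  proof (rule sum_mono)
    fix g assume "g \<in> G"
    then have g: "g\<^sup>2 dvd n" by (simp add: G_def)
    then have pos: "n div g\<^sup>2 > 0" using assms by (metis dvd_div_eq_0_iff gr0I)
    have "card ((\<lambda>(x, y). (g * x, g * y)) ` P g) \<le> card (P g)"
      by (rule card_image_le[OF finP])
    also have "\<dots> \<le> card {d. d dvd n div g\<^sup>2}"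
      unfolding P_def by (rule card_primitive_odd_two_squares[OF pos])
    also have "\<dots> \<le> card {d. d dvd n}"
    proof (rule card_mono[OF fin])
      have "n div g\<^sup>2 dvd n" using g by (metis dvd_div_mult_self dvd_triv_left)
      then show "{d. d dvd n div g\<^sup>2} \<subseteq> {d. d dvd n}" by (auto intro: dvd_trans)
    qed
    finally show "card ((\<lambda>(x, y). (g * x, g * y)) ` P g) \<le> card {d. d dvd n}" .
  qed
  also have "\<dots> = card G * card {d. d dvd n}" by simp
  also have "\<dots> \<le> card {d. d dvd n} * card {d. d dvd n}"
    using card_mono[OF fin G] by simp
  finally show ?thesis by (simp add: power2_eq_square)
qed

section \<open>Resonant pairs of degrees\<close>

definition resonances :: "nat \<Rightarrow> nat \<Rightarrow> nat \<Rightarrow> (nat \<times> nat) set" where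
  "resonances N M k = {(n, m). n \<in> {N..<2 * N} \<and> m \<in> {M..<2 * M} \<and> n * (n + 1) + m * (m + 1) = k}"

lemma finite_resonances: "finite (resonances N M k)"
  by (rule finite_subset[of _ "{N..<2 * N} \<times> {M..<2 * M}"]) (auto simp: resonances_def)

text \<open>Passing from \<open>n\<close> to \<open>n + 1\<close> raises \<open>n * (n + 1)\<close>
  by \<open>2 * (n + 1) > 4 * M\<^sup>2\<close>, whereas
  \<open>m * (m + 1) \<le> 4 * M\<^sup>2\<close>. So \<open>k\<close> determines \<open>n\<close>,
  and then \<open>m\<close>.\<close>

lemma card_resonances_le_one:
  assumes "N > 2 * M\<^sup>2"
  shows "card (resonances N M k) \<le> 1"
proof -
  have le: "n' \<le> n" if nm: "(n, m) \<in> resonances N M k" "(n', m') \<in> resonances N M k" for n m n' m'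
  proof (rule ccontr)
    assume "\<not> n' \<le> n"
    then have "n + 1 \<le> n'" by simp
    then have "(n + 1) * (n + 2) \<le> n' * (n' + 1)" by (intro mult_mono) auto
    moreover have "N \<le> n" "n * (n + 1) + m * (m + 1) = n' * (n' + 1) + m' * (m' + 1)"
      using nm by (auto simp: resonances_def)
    moreover have "m + 1 \<le> 2 * M" using nm by (auto simp: resonances_def)
    then have "m * (m + 1) \<le> (2 * M) * (2 * M)" by (intro mult_mono) auto
    ultimately show False using assms by (simp add: algebra_simps power2_eq_square)
  qed
  have "x = y" if "x \<in> resonances N M k" "y \<in> resonances N M k" for x y
  proof -
    obtain n m n' m' where xy: "x = (n, m)" "y = (n', m')" by (metis surj_pair)
    have n: "n = n'" using le that unfolding xy by (meson le_antisym)
    then have "m * (m + 1) = m' * (m' + 1)" using that unfolding xy by (simp add: resonances_def)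
    moreover have "a * (a + 1) < b * (b + 1)" if "a < b" for a b :: nat
      using that by (intro mult_strict_mono) auto
    ultimately have "m = m'" by (metis linorder_neqE_nat order_less_irrefl)
    with n show ?thesis by (simp add: xy)
  qed
  then show ?thesis using card_le_Suc0_iff_eq[OF finite_resonances] by (metis One_nat_def)
qed

lemma card_resonances_le_two_squares:
  "card (resonances N M k) \<le> card (odd_two_squares (4 * k + 2))"
proof (rule card_inj_on_le)
  show "inj_on (\<lambda>(n, m). (2 * n + 1, 2 * m + 1)) (resonances N M k)"
    by (auto simp: inj_on_def)
  show "(\<lambda>(n, m). (2 * n + 1, 2 * m + 1)) ` resonances N M k \<subseteq> odd_two_squares (4 * k + 2)"
    by (auto simp: resonances_def odd_two_squares_def power2_eq_square algebra_simps)
qed (rule finite_odd_two_squares)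

lemma card_resonances_bound:
  fixes \<epsilon> :: real
  assumes "\<epsilon> > 0"
  shows "\<exists>C\<ge>1. \<forall>N M k. 1 \<le> M \<longrightarrow> M \<le> N \<longrightarrow> real (card (resonances N M k)) \<le> C * real M powr \<epsilon>"
proof -
  \<comment> \<open>The exponent is doubled by squaring the divisor count and multiplied by 4 by the
    bound \<open>M ^ 4\<close>; \<open>\<epsilon> / 8\<close> therefore ends as
    \<open>\<epsilon>\<close>.\<close>
  obtain D where D: "D \<ge> 1" "\<And>n. n > 0 \<Longrightarrow> real (card {d. d dvd n}) \<le> D * real n powr (\<epsilon> / 8)"
    using divisor_bound[of "\<epsilon> / 8"] assms by auto
  define C where "C = D\<^sup>2 * 130 powr (\<epsilon> / 4)"
  have C: "C \<ge> 1" unfolding C_def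
    using D(1) assms by (intro mult_ge1_I one_le_power ge_one_powr_ge_zero) auto
  have "real (card (resonances N M k)) \<le> C * real M powr \<epsilon>" if M: "1 \<le> M" "M \<le> N" for N M k
  proof (cases "N > 2 * M\<^sup>2 \<or> resonances N M k = {}")
    case True
    then have "real (card (resonances N M k)) \<le> 1"
      using card_resonances_le_one by fastforce
    also have "1 \<le> C * real M powr \<epsilon>"
      using C M assms by (intro mult_ge1_I ge_one_powr_ge_zero) auto
    finally show ?thesis .
  next
    case False
    then obtain n m where nm: "(n, m) \<in> resonances N M k" and N: "N \<le> 2 * M\<^sup>2" by fastforce
    then have k: "k = n * (n + 1) + m * (m + 1)" and "n + 1 \<le> 2 * N" "m + 1 \<le> 2 * N"
      using M by (auto simp: resonances_def)
    \<comment> \<open>In this range \<open>k \<le> 8 * N\<^sup>2 \<le> 32 * M ^ 4\<close>, which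
      gives \<open>4 * k + 2 \<le> 130 * M ^ 4\<close>.\<close>
    then have "n * (n + 1) \<le> (2 * N) * (2 * N)" "m * (m + 1) \<le> (2 * N) * (2 * N)"
      by (intro mult_mono; simp)+
    then have "k \<le> 8 * N\<^sup>2" using k by (simp add: power2_eq_square)
    also have "N\<^sup>2 \<le> (2 * M\<^sup>2)\<^sup>2" using N by (intro power_mono) auto
    finally have "k \<le> 32 * M ^ 4" by (simp add: power2_eq_square power4_eq_xxxx)
    moreover have "M ^ 4 \<ge> 1" using M by simp
    ultimately have Q: "4 * k + 2 \<le> 130 * M ^ 4" by linarith
    have "real (card (resonances N M k)) \<le> real ((card {d. d dvd 4 * k + 2})\<^sup>2)"
      using card_resonances_le_two_squares[of N M k] card_odd_two_squares[of "4 * k + 2"] by linarith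
    also have "\<dots> \<le> (D * real (4 * k + 2) powr (\<epsilon> / 8))\<^sup>2"
      using D(2)[of "4 * k + 2"] by (simp only: of_nat_power) (intro power_mono, auto)
    also have "\<dots> = D\<^sup>2 * real (4 * k + 2) powr (\<epsilon> / 4)"
      by (simp add: power_mult_distrib power2_eq_square powr_add[symmetric])
    also have "\<dots> \<le> D\<^sup>2 * real (130 * M ^ 4) powr (\<epsilon> / 4)"
      using Q assms by (intro mult_left_mono powr_mono2) (auto simp only: of_nat_le_iff of_nat_0_le_iff, auto)
    also have "\<dots> = C * real M powr \<epsilon>"
    proof -
      have "(real M ^ 4) powr (\<epsilon> / 4) = (real M powr 4) powr (\<epsilon> / 4)" using M by simp
      then have "(real M ^ 4) powr (\<epsilon> / 4) = real M powr \<epsilon>" unfolding powr_powr by simp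
      then show ?thesis by (simp add: C_def powr_mult)
    qed
    finally show ?thesis .
  qed
  then show ?thesis using C by blast
qed

section \<open>Legendre polynomials\<close>

text \<open>The derivative again has the form of a power times a cofactor, so it can be iterated; at
  \<open>a\<close> the new cofactor is \<open>Suc n\<close> times the old one.\<close>

lemma pderiv_linear_power_mult:
  fixes q :: "real poly"
  shows "pderiv ([:-a, 1:] ^ Suc n * q) = [:-a, 1:] ^ n * (smult (real (Suc n)) q + [:-a, 1:] * pderiv q)"
proof -
  have "pderiv ([:-a, 1:] ^ Suc n) = smult (real (Suc n)) ([:-a, 1:] ^ n)"
    by (simp add: pderiv_power_Suc pderiv_pCons del: power_Suc)
  then show ?thesis
    unfolding pderiv_mult by (simp only: power_Suc distrib_left mult_smult_left mult_smult_right mult_ac)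
qed

lemma poly_higher_pderiv_root:
  fixes q :: "real poly"
  shows "poly ((pderiv ^^ n) ([:-a, 1:] ^ n * q)) a = fact n * poly q a"
proof (induction n arbitrary: q)
  case (Suc n)
  show ?case
    unfolding funpow_Suc_right o_apply pderiv_linear_power_mult Suc.IH by simp
qed simp

text \<open>Makes the boundary terms vanish when Rodrigues' formula is integrated by parts.\<close>

lemma poly_higher_pderiv_root_eq_0:
  fixes q :: "real poly"
  assumes "k < n"
  shows "poly ((pderiv ^^ k) ([:-a, 1:] ^ n * q)) a = 0"
  using assms
proof (induction k arbitrary: n q)
  case 0
  then show ?case by (cases n) auto
next
  case (Suc k)
  then obtain n' where n: "n = Suc n'" "k < n'" by (cases n) auto
  show ?case
    unfolding n(1) funpow_Suc_right o_apply pderiv_linear_power_mult by (rule Suc.IH[OF n(2)])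
qed

text \<open>The unsimplified \<open>-(-1)\<close> matches the pattern \<open>[:-a, 1:]\<close> with
  \<open>a = -1\<close>.\<close>

lemma rodrigues_factor:
  "[:-1, 0, 1:] ^ n = [:-1, 1:] ^ n * [:1, 1::real:] ^ n"
  "[:-1, 0, 1:] ^ n = [:-(-1), 1:] ^ n * [:-1, 1::real:] ^ n"
proof -
  have "[:-1, 0, 1:] = [:-1, 1:] * [:1, 1::real:]" "[:-1, 0, 1:] = [:-(-1), 1:] * [:-1, 1::real:]" by simp_all
  then show "[:-1, 0, 1:] ^ n = [:-1, 1:] ^ n * [:1, 1::real:] ^ n"
    "[:-1, 0, 1:] ^ n = [:-(-1), 1:] ^ n * [:-1, 1::real:] ^ n"
    by (metis power_mult_distrib)+
qed

lemma poly_legendre_1: "poly (legendre_poly n) 1 = 1"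
  unfolding legendre_poly_def rodrigues_factor(1) poly_smult
  using poly_higher_pderiv_root[of n 1 "[:1, 1:] ^ n"] by simp

lemma poly_legendre_minus_1: "poly (legendre_poly n) (-1) = (-1) ^ n"
  unfolding legendre_poly_def rodrigues_factor(2) poly_smult
  using poly_higher_pderiv_root[of n "-1" "[:-1, 1:] ^ n"] by (simp add: power_minus[of 2])

text \<open>The power \<open>w = (x\<^sup>2 - 1) ^ n\<close> satisfies
  \<open>(x\<^sup>2 - 1) * w' = 2 * n * x * w\<close>; differentiating this \<open>k + 1\<close>
  times gives the claim. The case \<open>k = n\<close> is the Legendre equation.\<close>

lemma rodrigues_ode:
  fixes n k :: nat and x :: real
  defines "D \<equiv> \<lambda>k. (pderiv ^^ k) ([:-1, 0, 1::real:] ^ n)"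
  shows "(x\<^sup>2 - 1) * poly (D (k + 2)) x + 2 * (real k + 1 - real n) * x * poly (D (k + 1)) x
      + ((real k + 1) * real k - 2 * real n * (real k + 1)) * poly (D k) x = 0"
proof -
  have Suc_D: "D (Suc k) = pderiv (D k)" for k by (simp add: D_def)
  have first: "[:-1, 0, 1:] * D 1 = smult (2 * real n) ([:0, 1:] * D 0)"
  proof (cases n)
    case 0
    then show ?thesis by (simp add: D_def)
  next
    case (Suc m)
    show ?thesis unfolding D_def Suc
      by (simp add: pderiv_power_Suc pderiv_pCons del: of_nat_Suc power_Suc) (simp add: algebra_simps)
  qed
  have "[:-1, 0, 1:] * D (k + 2) + smult (2 * (real k + 1 - real n)) ([:0, 1:] * D (k + 1))
      + smult ((real k + 1) * real k - 2 * real n * (real k + 1)) (D k) = 0"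
  proof (induction k)
    case 0
    have "pderiv ([:-1, 0, 1:] * D 1 - smult (2 * real n) ([:0, 1:] * D 0)) = 0"
      by (simp only: first) simp
    then have "poly (pderiv ([:-1, 0, 1:] * D 1 - smult (2 * real n) ([:0, 1:] * D 0))) x = 0" for x
      by simp
    then show ?case
      by (intro poly_eq_poly_eq_iff[THEN iffD1] ext)
        (simp add: pderiv_mult pderiv_add pderiv_diff pderiv_smult pderiv_pCons Suc_D[symmetric] numeral_2_eq_2
          algebra_simps)
  next
    case (Suc k)
    then have "poly (pderiv ([:-1, 0, 1:] * D (k + 2)
      + smult (2 * (real k + 1 - real n)) ([:0, 1:] * D (k + 1))
      + smult ((real k + 1) * real k - 2 * real n * (real k + 1)) (D k))) x = 0" for x
      by (simp only:) simp
    then show ?case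
      by (intro poly_eq_poly_eq_iff[THEN iffD1] ext)
        (simp add: pderiv_mult pderiv_add pderiv_diff pderiv_smult pderiv_pCons Suc_D[symmetric] numeral_2_eq_2
          algebra_simps)
  qed
  then have "poly ([:-1, 0, 1:] * D (k + 2) + smult (2 * (real k + 1 - real n)) ([:0, 1:] * D (k + 1))
      + smult ((real k + 1) * real k - 2 * real n * (real k + 1)) (D k)) x = 0" by simp
  then show ?thesis by (simp add: power2_eq_square algebra_simps)
qed

lemma legendre_ode:
  fixes n :: nat and x :: real
  defines "P \<equiv> legendre_poly n"
  shows "(1 - x\<^sup>2) * poly (pderiv (pderiv P)) x = 2 * x * poly (pderiv P) x - real n * (real n + 1) * poly P x"
proof -
  have "(1 - x\<^sup>2) * poly ((pderiv ^^ (n + 2)) ([:-1, 0, 1:] ^ n)) x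
      = 2 * x * poly ((pderiv ^^ (n + 1)) ([:-1, 0, 1:] ^ n)) x
        - real n * (real n + 1) * poly ((pderiv ^^ n) ([:-1, 0, 1:] ^ n)) x"
    using rodrigues_ode[of x n n] by (simp add: algebra_simps)
  then show ?thesis
    unfolding P_def legendre_poly_def pderiv_smult poly_smult
    by (simp add: field_simps)
qed

lemma legendre_0: "legendre_poly 0 = 1"
  by (simp add: legendre_poly_def)

section \<open>Pointwise bounds for Legendre polynomials\<close>

text \<open>Such an \<open>F\<close> decreases up to 0 and increases afterwards. Both pointwise
  bounds use this for an energy: one compares with the endpoints, the other (with the sign reversed)
  with the value at 0.\<close>

lemma mono_away_from_zero:
  fixes F F' :: "real \<Rightarrow> real"
  assumes "\<And>x. \<bar>x\<bar> \<le> 1 \<Longrightarrow> (F has_real_derivative F' x) (at x)"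
    and "\<And>x. \<bar>x\<bar> \<le> 1 \<Longrightarrow> 0 \<le> x * F' x"
    and "\<bar>x\<bar> \<le> 1"
  shows "F 0 \<le> F x" "F x \<le> max (F 1) (F (-1))"
proof -
  have cont: "continuous_on {a..b} F" if "-1 \<le> a" "b \<le> 1" for a b
    by (intro continuous_at_imp_continuous_on ballI, rule DERIV_isCont[OF assms(1)]) (use that in auto)
  have inc: "F a \<le> F b" if "0 \<le> a" "a \<le> b" "b \<le> 1" for a b
  proof (rule DERIV_nonneg_imp_increasing_open[OF that(2)])
    fix y assume y: "a < y" "y < b"
    then have "F' y \<ge> 0" using assms(2)[of y] that by (auto simp: zero_le_mult_iff)
    then show "\<exists>z. (F has_real_derivative z) (at y) \<and> z \<ge> 0" using assms(1)[of y] that y by auto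
  qed (use cont that in auto)
  have dec: "F b \<le> F a" if "-1 \<le> a" "a \<le> b" "b \<le> 0" for a b
  proof (rule DERIV_nonpos_imp_decreasing_open[OF that(2)])
    fix y assume y: "a < y" "y < b"
    then have "F' y \<le> 0" using assms(2)[of y] that by (auto simp: zero_le_mult_iff)
    then show "\<exists>z. (F has_real_derivative z) (at y) \<and> z \<le> 0" using assms(1)[of y] that y by auto
  qed (use cont that in auto)
  show "F 0 \<le> F x" "F x \<le> max (F 1) (F (-1))"
    using inc[of 0 x] inc[of x 1] dec[of "-1" x] dec[of x 0] assms(3)
    unfolding abs_le_iff le_max_iff_disj by linarith+
qed

text \<open>By the Legendre equation, the energy
  \<open>P\<^sup>2 + (1 - x\<^sup>2) * P'\<^sup>2 / (n * (n + 1))\<close> has derivative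
  \<open>2 * x * P'\<^sup>2 / (n * (n + 1))\<close>. It is therefore largest at an endpoint, where
  it equals 1.\<close>

lemma legendre_square_le_1:
  assumes "\<bar>x\<bar> \<le> 1"
  shows "(poly (legendre_poly n) x)\<^sup>2 \<le> 1"
proof (cases "n = 0")
  case False
  define P where "P = legendre_poly n"
  define l where "l = real n * (real n + 1)"
  have l: "l > 0" using False by (simp add: l_def)
  define F where "F = (\<lambda>x. (poly P x)\<^sup>2 + (1 - x\<^sup>2) * (poly (pderiv P) x)\<^sup>2 / l)"
  have DF: "(F has_real_derivative 2 * x * (poly (pderiv P) x)\<^sup>2 / l) (at x)" for x
  proof -
    have "(F has_real_derivative 2 * poly P x * poly (pderiv P) x + (- 2 * x * (poly (pderiv P) x)\<^sup>2
       + 2 * poly (pderiv P) x * ((1 - x\<^sup>2) * poly (pderiv (pderiv P)) x)) / l) (at x)"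
      unfolding F_def using l
      by (auto intro!: derivative_eq_intros poly_DERIV simp: field_simps power2_eq_square)
    also have "(1 - x\<^sup>2) * poly (pderiv (pderiv P)) x = 2 * x * poly (pderiv P) x - l * poly P x"
      unfolding P_def l_def by (rule legendre_ode)
    finally show ?thesis using l by (simp add: field_simps power2_eq_square)
  qed
  have eq: "x * (2 * x * (poly (pderiv P) x)\<^sup>2 / l) = 2 * x\<^sup>2 * (poly (pderiv P) x)\<^sup>2 / l" for x
    by (simp add: power2_eq_square)
  have nonneg: "0 \<le> x * (2 * x * (poly (pderiv P) x)\<^sup>2 / l)" for x unfolding eq using l by simp
  have "F x \<le> max (F 1) (F (-1))" by (rule mono_away_from_zero(2)[OF DF nonneg assms])
  also have "\<dots> = 1"
    unfolding F_def P_def by (simp add: poly_legendre_1 poly_legendre_minus_1 flip: power_mult)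
  finally have "F x \<le> 1" .
  moreover have "0 \<le> (1 - x\<^sup>2) * (poly (pderiv P) x)\<^sup>2 / l"
    using assms l by (intro divide_nonneg_pos mult_nonneg_nonneg) (auto simp: abs_square_le_1)
  ultimately show ?thesis unfolding F_def P_def by linarith
qed (simp add: legendre_0)

text \<open>The sign exponent \<open>n + i div 2\<close> has the parity of
  \<open>n - i div 2\<close> and avoids truncated subtraction.\<close>

lemma coeff_rodrigues:
  "coeff ([:-1, 0, 1::real:] ^ n) i = (if even i then (-1) ^ (n + i div 2) * real (n choose (i div 2)) else 0)"
proof (induction n arbitrary: i)
  case 0
  show ?case by (cases i) (auto elim!: evenE simp: coeff_eq_0)
next
  case (Suc n)
  consider "i = 0" | "i = 1" | j where "i = Suc (Suc j)" by (metis One_nat_def not0_implies_Suc)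
  then show ?case
    by cases (auto simp: Suc.IH algebra_simps)
qed

text \<open>Squared to avoid roots. The ratio of successive terms is
  \<open>((2 * k + 1) / (2 * k + 2))\<^sup>2\<close>, and the induction closes because
  \<open>(2 * k + 1) * (2 * k + 3) \<le> (2 * k + 2)\<^sup>2\<close>.\<close>

lemma central_binomial_upper_bound:
  "(real ((2 * k) choose k) / 4 ^ k)\<^sup>2 \<le> 1 / (2 * real k + 1)"
proof (induction k)
  case (Suc k)
  have step: "real ((2 * Suc k) choose Suc k) = real ((2 * k) choose k) * (2 * (2 * real k + 1) / (real k + 1))"
    by (subst (1 2) binomial_fact) (auto simp: divide_simps, simp add: algebra_simps)
  have "(real ((2 * Suc k) choose Suc k) / 4 ^ Suc k)\<^sup>2
      = (real ((2 * k) choose k) / 4 ^ k)\<^sup>2 * ((2 * real k + 1) / (2 * (real k + 1)))\<^sup>2"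
    unfolding step power_mult_distrib[symmetric]
    by (rule arg_cong[where f = "\<lambda>x. x\<^sup>2"]) (simp add: divide_simps, simp add: algebra_simps)
  also have "\<dots> \<le> 1 / (2 * real k + 1) * ((2 * real k + 1) / (2 * (real k + 1)))\<^sup>2"
    by (intro mult_right_mono Suc.IH) auto
  also have "\<dots> = (2 * real k + 1) / (2 * (real k + 1))\<^sup>2"
    by (simp add: power_divide power2_eq_square[of "2 * real k + 1"])
  also have "\<dots> \<le> 1 / (2 * real (Suc k) + 1)"
    by (simp add: divide_simps) (simp add: power2_eq_square algebra_simps)
  finally show ?case .
qed simp

lemma legendre_at_0:
  "poly (legendre_poly n) 0 = coeff ([:-1, 0, 1:] ^ n) n / 2 ^ n"
  "poly (pderiv (legendre_poly n)) 0 = (real n + 1) * coeff ([:-1, 0, 1:] ^ n) (Suc n) / 2 ^ n"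
proof -
  have "poly ((pderiv ^^ k) w) 0 = fact k * coeff w k" for k and w :: "real poly"
    by (simp add: poly_0_coeff_0 coeff_higher_pderiv pochhammer_fact[symmetric])
  from this[of n] this[of "Suc n"] show
  "poly (legendre_poly n) 0 = coeff ([:-1, 0, 1:] ^ n) n / 2 ^ n"
  "poly (pderiv (legendre_poly n)) 0 = (real n + 1) * coeff ([:-1, 0, 1:] ^ n) (Suc n) / 2 ^ n"
    by (simp_all add: legendre_poly_def pderiv_smult field_simps)
qed

text \<open>The starting value for Sonin's method, at the equator. By parity one of the two terms
  vanishes, and the other is expressed by a central binomial coefficient.\<close>

lemma legendre_amplitude_at_0:
  "(poly (legendre_poly n) 0)\<^sup>2 + 4 * (poly (pderiv (legendre_poly n)) 0)\<^sup>2 / (4 * (real n * (real n + 1)) + 2)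
     \<le> 2 / (real n + 1)"
proof (cases "even n")
  case True
  then obtain k where n: "n = 2 * k" by (auto elim!: evenE)
  have "(poly (legendre_poly n) 0)\<^sup>2 = (real ((2 * k) choose k) / 4 ^ k)\<^sup>2"
    unfolding legendre_at_0 coeff_rodrigues n
    by (simp add: power_divide power_mult_distrib power_mult flip: power_even_eq)
  also have "\<dots> \<le> 1 / (real n + 1)"
    using central_binomial_upper_bound[of k] by (simp add: n)
  also have "\<dots> \<le> 2 / (real n + 1)" by (simp add: divide_right_mono)
  finally show ?thesis unfolding legendre_at_0(2) coeff_rodrigues using True by simp
next
  case False
  then obtain j where j: "n = 2 * j + 1" by (auto elim!: oddE)
  define k where "k = Suc j"
  have n: "Suc n = 2 * k" "real n = 2 * real k - 1" and k: "real k \<ge> 1" by (auto simp: k_def j)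
  \<comment> \<open>Pascal's rule and symmetry bring the odd case back to a central
    coefficient.\<close>
  have c: "real (2 * k choose k) = 2 * real (n choose k)"
  proof -
    have "2 * k choose k = (n choose j) + (n choose Suc j)" by (simp add: k_def j)
    also have "n choose j = n choose Suc j" by (subst binomial_symmetric) (auto simp: j)
    finally show ?thesis by (simp add: k_def)
  qed
  have times_4: "4 * a \<le> b" if "a \<le> b / 4" for a b :: real using that by simp
  have "(poly (pderiv (legendre_poly n)) 0)\<^sup>2 = (2 * real k * (real ((2 * k) choose k) / 4 ^ k))\<^sup>2"
  proof -
    have "(4::real) ^ k = 2 ^ (2 * k)" by (simp add: power_mult)
    then have "(4::real) ^ k = 2 * 2 ^ n" by (simp only: n(1)[symmetric] power_Suc)
    then have "real (2 * k choose k) / 4 ^ k = real (n choose k) / 2 ^ n" unfolding c by simp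
    then show ?thesis
      unfolding legendre_at_0(2) coeff_rodrigues n(1)
      by (simp add: n(2) power_divide power_mult_distrib flip: power_mult)
  qed
  also have "\<dots> \<le> 4 * (real k)\<^sup>2 * (1 / (2 * real k + 1))"
    unfolding power_mult_distrib[of "2 * real k"]
    using central_binomial_upper_bound[of k] by (intro mult_mono) (auto simp: power_mult_distrib)
  also have "\<dots> \<le> (4 * (real n * (real n + 1)) + 2) * (2 / (real n + 1)) / 4"
  proof -
    \<comment> \<open>Clearing denominators reduces the claim to
      \<open>4 * k \<le> 2 + 16 * k ^ 3\<close>.\<close>
    have "1 \<le> real k * real k" by (rule mult_ge1_I[OF k k])
    then have "real k * 1 \<le> real k * (real k * real k)" by (rule mult_left_mono) simp
    then have "real k * 4 \<le> 2 + real k * (real k * (real k * 16))" by simp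
    then show ?thesis using k unfolding n(2) by (simp add: field_simps power2_eq_square)
  qed
  finally have "4 * (poly (pderiv (legendre_poly n)) 0)\<^sup>2 \<le> (4 * (real n * (real n + 1)) + 2) * (2 / (real n + 1))"
    by (rule times_4)
  moreover have "4 * (real n * (real n + 1)) + 2 > 0" by (simp add: add_nonneg_pos)
  ultimately have "4 * (poly (pderiv (legendre_poly n)) 0)\<^sup>2 / (4 * (real n * (real n + 1)) + 2) \<le> 2 / (real n + 1)"
    by (simp add: divide_le_eq mult.commute)
  moreover have "poly (legendre_poly n) 0 = 0" unfolding legendre_at_0(1) coeff_rodrigues using False by simp
  ultimately show ?thesis by simp
qed

text \<open>
  Sonin's method. In the variable \<open>x = cos \<theta>\<close>, the function \<open>u = sin\<^sup>1\<^sup>/\<^sup>2 \<theta> P\<^sub>n (cos \<theta>)\<close> solves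
  \<open>u'' + \<phi> u = 0\<close> with \<open>\<phi> = (n + 1/2)\<^sup>2 + 1 / (4 sin\<^sup>2 \<theta>)\<close>, and \<open>F\<close> below is the square of
  \<open>u\<^sup>2 + u'\<^sup>2 / \<phi>\<close>.
\<close>
lemma legendre_bernstein:
  assumes x: "\<bar>x\<bar> \<le> 1"
  shows "(1 - x\<^sup>2) * ((2 * real n + 1) * (poly (legendre_poly n) x)\<^sup>2)\<^sup>2 \<le> 16"
proof -
  define P where "P = poly (legendre_poly n)"
  define P' where "P' = poly (pderiv (legendre_poly n))"
  define l where "l = real n * (real n + 1)"
  have l: "l \<ge> 0" by (simp add: l_def)
  \<comment> \<open>With \<open>s = sin \<theta>\<close>: \<open>W\<close> is
    \<open>-2 * sqrt s * u'\<close>, \<open>T\<close> is \<open>4 * s\<^sup>2 * \<phi>\<close>, and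
    \<open>R\<close> is \<open>(u\<^sup>2 + u'\<^sup>2 / \<phi>) / s\<close>. Squaring in
    \<open>F\<close> removes the root of \<open>1 - x\<^sup>2\<close>, so that \<open>F\<close> is
    differentiable at the endpoints too.\<close>
  define W where "W = (\<lambda>x. 2 * (1 - x\<^sup>2) * P' x - x * P x)"
  define T where "T = (\<lambda>x. (4 * l + 1) * (1 - x\<^sup>2) + 1)"
  define R where "R = (\<lambda>x. (P x)\<^sup>2 + (W x)\<^sup>2 / T x)"
  define F where "F = (\<lambda>x. (1 - x\<^sup>2) * (R x)\<^sup>2)"
  have T: "T x > 0" if "\<bar>x\<bar> \<le> 1" for x
    unfolding T_def using that l by (intro add_nonneg_pos mult_nonneg_nonneg) (auto simp: abs_square_le_1)
  have R: "R x \<ge> (P x)\<^sup>2" if "\<bar>x\<bar> \<le> 1" for x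
    using T[OF that] by (simp add: R_def)
  have DP: "(P has_real_derivative P' x) (at x)" for x
    unfolding P_def P'_def by (rule poly_DERIV)
  have DW: "(W has_real_derivative - ((2 * l + 1) * P x + x * P' x)) (at x)" for x
  proof -
    have "(W has_real_derivative - 4 * x * P' x + 2 * ((1 - x\<^sup>2) * poly (pderiv (pderiv (legendre_poly n))) x)
        - P x - x * P' x) (at x)"
      unfolding W_def P_def P'_def
      by (auto intro!: derivative_eq_intros poly_DERIV simp: algebra_simps)
    also have "(1 - x\<^sup>2) * poly (pderiv (pderiv (legendre_poly n))) x = 2 * x * P' x - l * P x"
      unfolding P_def P'_def l_def by (rule legendre_ode)
    finally show ?thesis by (rule DERIV_cong) (simp add: algebra_simps)
  qed
  define F' where "F' = (\<lambda>x. - 4 * x * R x * (W x)\<^sup>2 / (T x)\<^sup>2)"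
  have DF: "(F has_real_derivative F' x) (at x)" if x: "\<bar>x\<bar> \<le> 1" for x
  proof -
    have Tx: "T x \<noteq> 0" using T[OF x] by simp
    have DT: "(T has_real_derivative - 2 * (4 * l + 1) * x) (at x)"
      unfolding T_def by (auto intro!: derivative_eq_intros simp: algebra_simps)
    define W' where "W' = - ((2 * l + 1) * P x + x * P' x)"
    define R' where "R' = 2 * P x * P' x + (2 * W x * W' * T x + (W x)\<^sup>2 * (2 * (4 * l + 1) * x)) / (T x)\<^sup>2"
    have DR: "(R has_real_derivative R') (at x)"
      unfolding R_def R'_def W'_def
      by (rule derivative_eq_intros DP DW DT Tx refl | simp)+
         (simp add: power2_eq_square algebra_simps)
    \<comment> \<open>The choice of \<open>T\<close> makes everything but a multiple of
      \<open>W\<close> cancel, so the derivative of \<open>F\<close> becomes \<open>- x\<close>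
      times a nonnegative factor.\<close>
    have key: "T x * P x + 2 * (1 - x\<^sup>2) * W' - x * W x = - 2 * x * W x"
      by (simp add: T_def W'_def W_def algebra_simps power2_eq_square)
    have PW: "(1 - x\<^sup>2) * (2 * P x * P' x) - x * (P x)\<^sup>2 = P x * W x"
      by (simp add: W_def algebra_simps power2_eq_square)
    have "(T x)\<^sup>2 * ((1 - x\<^sup>2) * R' - x * R x)
        = (T x)\<^sup>2 * ((1 - x\<^sup>2) * (2 * P x * P' x) - x * (P x)\<^sup>2)
          + (1 - x\<^sup>2) * (2 * W x * W' * T x + (W x)\<^sup>2 * (2 * (4 * l + 1) * x)) - x * (W x)\<^sup>2 * T x"
      using Tx by (simp add: R_def R'_def field_simps power2_eq_square)
    also have "\<dots> = W x * (T x * (T x * P x + 2 * (1 - x\<^sup>2) * W' - x * W x)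
          + 2 * x * (T x - 1) * W x)"
      unfolding PW by (simp add: T_def algebra_simps power2_eq_square)
    also have "\<dots> = - 2 * x * (W x)\<^sup>2"
      unfolding key by (simp add: algebra_simps power2_eq_square)
    finally have eq: "(1 - x\<^sup>2) * R' - x * R x = - 2 * x * (W x)\<^sup>2 / (T x)\<^sup>2"
      using Tx by (simp add: field_simps)
    have "(F has_real_derivative 2 * R x * ((1 - x\<^sup>2) * R' - x * R x)) (at x)"
      unfolding F_def
      by (rule derivative_eq_intros DR refl | simp)+ (simp add: power2_eq_square algebra_simps)
    then show ?thesis unfolding eq F'_def by (simp add: mult.assoc mult.left_commute)
  qed
  \<comment> \<open>\<open>F\<close> decreases away from the equator, so the lemma is applied to
    \<open>- F\<close>.\<close>
  have "- F x \<ge> - F 0"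
  proof (rule mono_away_from_zero(1)[of "\<lambda>x. - F x" "\<lambda>x. - F' x", OF _ _ x])
    fix y :: real assume y: "\<bar>y\<bar> \<le> 1"
    show "((\<lambda>x. - F x) has_real_derivative - F' y) (at y)" using DF[OF y] by (rule DERIV_minus)
    have "y * - F' y = 4 * y\<^sup>2 * R y * (W y)\<^sup>2 / (T y)\<^sup>2" by (simp add: F'_def power2_eq_square)
    moreover have "R y \<ge> 0" using R[OF y] by (meson order_trans zero_le_power2)
    ultimately show "0 \<le> y * - F' y" by simp
  qed
  then have "F x \<le> (R 0)\<^sup>2" by (simp add: F_def)
  also have "R 0 \<le> 2 / (real n + 1)"
    using legendre_amplitude_at_0[of n]
    by (simp add: R_def W_def T_def P_def P'_def l_def power_mult_distrib algebra_simps)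
  then have "(R 0)\<^sup>2 \<le> (2 / (real n + 1))\<^sup>2"
    using R[of 0] by (intro power_mono) (auto intro: order_trans[OF zero_le_power2])
  finally have F: "F x \<le> (2 / (real n + 1))\<^sup>2" .
  have "(1 - x\<^sup>2) * ((P x)\<^sup>2)\<^sup>2 \<le> F x"
    unfolding F_def using R[OF x] x by (intro mult_left_mono power_mono) (auto simp: abs_square_le_1)
  with F have "(1 - x\<^sup>2) * ((P x)\<^sup>2)\<^sup>2 \<le> (2 / (real n + 1))\<^sup>2" by simp
  then have "(2 * real n + 1)\<^sup>2 * ((1 - x\<^sup>2) * ((P x)\<^sup>2)\<^sup>2) \<le> (2 * real n + 1)\<^sup>2 * (2 / (real n + 1))\<^sup>2"
    by (intro mult_left_mono) auto
  also have "\<dots> = ((2 * real n + 1) * (2 / (real n + 1)))\<^sup>2" by (simp only: power_mult_distrib)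
  also have "\<dots> \<le> 4\<^sup>2" by (intro power_mono) (auto simp: field_simps)
  finally show ?thesis by (simp add: P_def power_mult_distrib mult_ac)
qed


section \<open>Orthogonality and norms of Legendre polynomials\<close>

lemma poly_has_integral:
  fixes p :: "real poly"
  shows "(poly (pderiv p) has_integral poly p 1 - poly p (-1)) {-1..1}"
proof (rule fundamental_theorem_of_calculus)
  fix x :: real
  have "(poly p has_real_derivative poly (pderiv p) x) (at x within {-1..1})"
    by (rule has_field_derivative_at_within[OF poly_DERIV])
  then show "(poly p has_vector_derivative poly (pderiv p) x) (at x within {-1..1})"
    by (simp add: has_real_derivative_iff_has_vector_derivative)
qed simp

lemma poly_integrable [simp, intro]:
  fixes p :: "real poly"
  shows "poly p integrable_on {a..b}"
  by (intro integrable_continuous_interval continuous_intros)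

definition integral_poly :: "real poly \<Rightarrow> real" where
  "integral_poly p = integral {-1..1} (poly p)"

lemma integral_poly_pderiv: "integral_poly (pderiv p) = poly p 1 - poly p (-1)"
  unfolding integral_poly_def by (rule integral_unique[OF poly_has_integral])

lemma integral_poly_add: "integral_poly (p + q) = integral_poly p + integral_poly q"
  unfolding integral_poly_def poly_add by (rule integral_add) auto

lemma integral_poly_smult: "integral_poly (smult c p) = c * integral_poly p"
  unfolding integral_poly_def poly_smult by simp

lemma integral_poly_0 [simp]: "integral_poly 0 = 0"
  using integral_poly_smult[of 0 0] by simp

lemma integral_poly_sum: "integral_poly (\<Sum>i\<in>A. p i) = (\<Sum>i\<in>A. integral_poly (p i))"
  by (induction A rule: infinite_finite_induct) (simp_all add: integral_poly_add)

text \<open>Repeated integration by parts moves all derivatives onto \<open>q\<close>, which they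
  annihilate. Fewer than \<open>n\<close> derivatives of \<open>(x\<^sup>2 - 1) ^ n\<close> vanish
  at both endpoints, so no boundary terms arise.\<close>

lemma integral_rodrigues_mult:
  assumes "k \<le> n" "q = 0 \<or> degree q < k"
  shows "integral_poly ((pderiv ^^ k) ([:-1, 0, 1:] ^ n) * q) = 0"
  using assms
proof (induction k arbitrary: q)
  case (Suc k)
  define u where "u = (pderiv ^^ k) ([:-1, 0, 1::real:] ^ n)"
  have "poly u 1 = 0" "poly u (-1) = 0"
    using poly_higher_pderiv_root_eq_0[of k n 1] poly_higher_pderiv_root_eq_0[of k n "-1"] Suc.prems(1)
    unfolding u_def by (simp add: rodrigues_factor(1), simp add: rodrigues_factor(2))
  then have "integral_poly (pderiv (u * q)) = 0" by (simp add: integral_poly_pderiv)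
  moreover have "integral_poly (u * pderiv q) = 0"
    unfolding u_def
    using Suc.prems by (intro Suc.IH) (auto simp: degree_pderiv pderiv_eq_0_iff)
  ultimately have "integral_poly (pderiv u * q) = 0"
    by (simp add: pderiv_mult integral_poly_add mult.commute)
  then show ?case by (simp add: u_def)
qed simp

lemma integral_legendre_mult:
  assumes "q = 0 \<or> degree q < n"
  shows "integral_poly (legendre_poly n * q) = 0"
  using integral_rodrigues_mult[OF order_refl assms] by (simp add: legendre_poly_def integral_poly_smult)

lemma degree_legendre: "degree (legendre_poly n) \<le> n"
proof -
  have "degree ([:-1, 0, 1::real:] ^ n) \<le> 2 * n"
    using degree_power_le[of "[:-1, 0, 1::real:]" n] by simp
  then show ?thesis unfolding legendre_poly_def
    by (intro order_trans[OF degree_smult_le]) (simp add: degree_higher_pderiv)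
qed

lemma legendre_orthogonal:
  assumes "n \<noteq> m"
  shows "integral_poly (legendre_poly n * legendre_poly m) = 0"
proof (cases "n < m")
  case True
  then show ?thesis using integral_legendre_mult[of "legendre_poly n" m] degree_legendre[of n]
    by (simp add: mult.commute)
next
  case False
  then show ?thesis using integral_legendre_mult[of "legendre_poly m" n] degree_legendre[of m] assms
    by simp
qed

text \<open>In \<open>q = x * P' - n * P\<close> the terms of degree \<open>n\<close> cancel, so
  \<open>q\<close> is orthogonal to \<open>P\<close>. Integrating
  \<open>(x * P\<^sup>2)' = (2 * n + 1) * P\<^sup>2 + 2 * P * q\<close> then leaves only the
  boundary values of \<open>x * P\<^sup>2\<close>.\<close>

lemma legendre_norm: "(2 * real n + 1) * integral_poly ((legendre_poly n)\<^sup>2) = 2"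
proof -
  define P where "P = legendre_poly n"
  define q where "q = [:0, 1:] * pderiv P - smult (real n) P"
  have "coeff q i = 0" if "i \<ge> n" for i
  proof -
    have "coeff q i = (real i - real n) * coeff P i"
      by (cases i) (auto simp: q_def coeff_pCons coeff_pderiv algebra_simps)
    also have "\<dots> = 0" using that degree_legendre[of n] by (cases "i = n") (auto simp: P_def coeff_eq_0)
    finally show ?thesis .
  qed
  then have "q = 0 \<or> degree q < n" by (metis leading_coeff_0_iff linorder_not_le)
  then have q: "integral_poly (P * q) = 0" unfolding P_def by (rule integral_legendre_mult)
  have "pderiv ([:0, 1:] * P\<^sup>2) = smult (2 * real n + 1) (P\<^sup>2) + smult 2 (P * q)"
    by (rule poly_eq_poly_eq_iff[THEN iffD1], rule ext)
      (simp add: q_def pderiv_mult pderiv_pCons power2_eq_square algebra_simps)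
  then have "integral_poly (pderiv ([:0, 1:] * P\<^sup>2)) = (2 * real n + 1) * integral_poly (P\<^sup>2)"
    by (simp add: integral_poly_add integral_poly_smult q)
  moreover have "integral_poly (pderiv ([:0, 1:] * P\<^sup>2)) = 2"
    unfolding integral_poly_pderiv P_def
    by (simp add: poly_legendre_1 poly_legendre_minus_1 flip: power_mult)
  ultimately show ?thesis by (simp add: P_def)
qed

section \<open>The integral of a product of two squared harmonics\<close>

text \<open>The substitution \<open>t = (x + 1) / 2\<close> turns \<open>1 - x\<^sup>2\<close> into
  \<open>4 * t * (1 - t)\<close> and the integral into Euler's Beta integral.\<close>

lemma has_integral_powr_1_minus_square:
  fixes a :: real
  assumes "a > 0"
  shows "((\<lambda>x. (1 - x\<^sup>2) powr (a - 1)) has_integral 2 * 4 powr (a - 1) * Beta a a) {-1..1}"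
proof -
  have "((\<lambda>t. t powr (a - 1) * (1 - t) powr (a - 1)) has_integral Beta a a) (cbox 0 1)"
    using has_integral_Beta_real[OF assms assms] by simp
  from has_integral_affinity'[OF this, of "1/2" "1/2"]
  have "((\<lambda>x. (x / 2 + 1 / 2) powr (a - 1) * (1 - (x / 2 + 1 / 2)) powr (a - 1)) has_integral 2 * Beta a a) {-1..1}"
    by simp
  then have "((\<lambda>x. 4 powr (a - 1) * ((x / 2 + 1 / 2) powr (a - 1) * (1 - (x / 2 + 1 / 2)) powr (a - 1)))
      has_integral 4 powr (a - 1) * (2 * Beta a a)) {-1..1}"
    by (rule has_integral_mult_right)
  moreover have "4 powr (a - 1) * ((x / 2 + 1 / 2) powr (a - 1) * (1 - (x / 2 + 1 / 2)) powr (a - 1))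
      = (1 - x\<^sup>2) powr (a - 1)" if "x \<in> {-1..1}" for x
  proof -
    have "1 - x\<^sup>2 = 4 * ((x / 2 + 1 / 2) * (1 - (x / 2 + 1 / 2)))"
      by (simp add: field_simps power2_eq_square)
    then show ?thesis using that by (simp only:) (subst powr_mult, auto)+
  qed
  ultimately show ?thesis
    using has_integral_cong[of "{-1..1}" "\<lambda>x. 4 powr (a - 1) * ((x / 2 + 1 / 2) powr (a - 1) * (1 - (x / 2 + 1 / 2)) powr (a - 1))"
      "\<lambda>x. (1 - x\<^sup>2) powr (a - 1)"] by (simp add: mult_ac)
qed

text \<open>Bernstein's bound for both factors would give \<open>1 / (1 - x\<^sup>2)\<close>, which
  is not integrable. Using the trivial bound for a power \<open>d\<close> of the second factor
  improves the exponent to \<open>d / 2 - 1 > -1\<close>.\<close>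

lemma legendre_product_pointwise:
  assumes d: "0 < d" "d \<le> 1" and x: "\<bar>x\<bar> < 1"
  shows "((2 * real n + 1) * (poly (legendre_poly n) x)\<^sup>2) * ((2 * real m + 1) * (poly (legendre_poly m) x)\<^sup>2)
    \<le> 16 * (2 * real m + 1) powr d * (1 - x\<^sup>2) powr (d / 2 - 1)"
proof -
  define s where "s = 1 - x\<^sup>2"
  define y where "y = (\<lambda>k. (2 * real k + 1) * (poly (legendre_poly k) x)\<^sup>2)"
  have s: "s > 0" using x by (simp add: s_def abs_square_less_1)
  have y0: "y k \<ge> 0" for k by (simp add: y_def)
  have y: "y k \<le> 4 * s powr (-1/2)" for k
  proof (rule power2_le_imp_le)
    have "s * (y k)\<^sup>2 \<le> 16" unfolding s_def y_def by (rule legendre_bernstein) (use x in simp)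
    then have "(y k)\<^sup>2 \<le> 16 / s" using s by (simp add: field_simps)
    also have "\<dots> = (4 * s powr (-1/2))\<^sup>2"
      using s by (simp add: power_mult_distrib power2_eq_square[of "s powr _"] powr_add[symmetric] powr_minus_divide
          powr_half_sqrt power_divide)
    finally show "(y k)\<^sup>2 \<le> (4 * s powr (-1/2))\<^sup>2" .
  qed simp
  have ym: "y m \<le> 2 * real m + 1"
    using legendre_square_le_1[of x m] x mult_left_mono[of "(poly (legendre_poly m) x)\<^sup>2" 1 "2 * real m + 1"]
    by (simp add: y_def)
  have "y m = y m powr d * y m powr (1 - d)"
    using y0[of m] by (cases "y m = 0") (auto simp: powr_add[symmetric])
  also have "\<dots> \<le> (2 * real m + 1) powr d * (4 * s powr (-1/2)) powr (1 - d)"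
    using y0 ym y d by (intro mult_mono powr_mono2) auto
  also have "\<dots> = (2 * real m + 1) powr d * (4 powr (1 - d) * s powr (d / 2 - 1 / 2))"
    using s by (simp add: powr_mult powr_powr algebra_simps diff_divide_distrib)
  also have "\<dots> \<le> (2 * real m + 1) powr d * (4 * s powr (d / 2 - 1 / 2))"
    using d powr_mono[of "1 - d" 1 "4::real"] by (intro mult_left_mono mult_right_mono) auto
  finally have "y n * y m \<le> (4 * s powr (-1/2)) * ((2 * real m + 1) powr d * (4 * s powr (d / 2 - 1 / 2)))"
    using y y0 by (intro mult_mono) auto
  also have "\<dots> = 16 * (2 * real m + 1) powr d * (s powr (-1/2) * s powr (d / 2 - 1 / 2))"
    by simp
  also have "s powr (-1/2) * s powr (d / 2 - 1 / 2) = s powr (d / 2 - 1)"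
    by (simp flip: powr_add)
  finally show ?thesis by (simp add: y_def s_def)
qed

text \<open>\<open>Y\<^sub>n\<close> as a polynomial in \<open>cos \<theta>\<close>. Its square has
  mean 1, hence integral 2 over the interval from -1 to 1.\<close>

definition legendre_normalized :: "nat \<Rightarrow> real poly" where
  "legendre_normalized n = smult (sqrt (2 * real n + 1)) (legendre_poly n)"

lemma legendre_normalized_orthonormal:
  "integral_poly (legendre_normalized n * legendre_normalized m) = (if n = m then 2 else 0)"
  using legendre_norm[of n] legendre_orthogonal[of n m]
  by (auto simp: legendre_normalized_def integral_poly_smult power2_eq_square mult.assoc[symmetric])

lemma integral_legendre_product_bound:
  fixes d :: real
  assumes d: "0 < d"
  shows "\<exists>C\<ge>1. \<forall>n m M. M \<ge> 1 \<longrightarrow> m < 2 * M \<longrightarrow>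
    integral_poly ((legendre_normalized n)\<^sup>2 * (legendre_normalized m)\<^sup>2) \<le> C * real M powr d"
proof -
  \<comment> \<open>The interpolation needs an exponent at most 1; lowering it only strengthens the
    bound, as \<open>M \<ge> 1\<close>.\<close>
  define e where "e = min d 1"
  have e: "0 < e" "e \<le> 1" "e \<le> d" using d by (auto simp: e_def)
  define B where "B = 2 * 4 powr (e / 2 - 1) * Beta (e / 2) (e / 2)"
  define C where "C = max 1 (64 * B)"
  have I: "((\<lambda>x. (1 - x\<^sup>2) powr (e / 2 - 1)) has_integral B) {-1..1}"
    unfolding B_def using e by (intro has_integral_powr_1_minus_square) auto
  have B: "B \<ge> 0" by (rule has_integral_nonneg[OF I]) auto
  have "integral_poly ((legendre_normalized n)\<^sup>2 * (legendre_normalized m)\<^sup>2) \<le> C * real M powr d"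
    if M: "M \<ge> 1" "m < 2 * M" for n m M
  proof -
    \<comment> \<open>The endpoints must be left out: there the majorant takes the default value
      \<open>0 powr _ = 0\<close>.\<close>
    have "(poly ((legendre_normalized n)\<^sup>2 * (legendre_normalized m)\<^sup>2) has_integral
       integral_poly ((legendre_normalized n)\<^sup>2 * (legendre_normalized m)\<^sup>2)) {-1<..<1}"
      unfolding integral_poly_def has_integral_Icc_iff_Ioo[symmetric] by (rule integrable_integral) auto
    moreover have "((\<lambda>x. 16 * (2 * real m + 1) powr e * (1 - x\<^sup>2) powr (e / 2 - 1)) has_integral
        16 * (2 * real m + 1) powr e * B) {-1<..<1}"
      unfolding has_integral_Icc_iff_Ioo[symmetric] by (rule has_integral_mult_right[OF I])
    ultimately have "integral_poly ((legendre_normalized n)\<^sup>2 * (legendre_normalized m)\<^sup>2)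
        \<le> 16 * (2 * real m + 1) powr e * B"
    proof (rule has_integral_le)
      fix x :: real assume "x \<in> {-1<..<1}"
      then have "\<bar>x\<bar> < 1" by auto
      from legendre_product_pointwise[OF e(1,2) this, of n m]
      show "poly ((legendre_normalized n)\<^sup>2 * (legendre_normalized m)\<^sup>2) x
          \<le> 16 * (2 * real m + 1) powr e * (1 - x\<^sup>2) powr (e / 2 - 1)"
        by (simp add: legendre_normalized_def power_mult_distrib)
    qed
    also have "(2 * real m + 1) powr e \<le> (4 * real M) powr e"
      using M e by (intro powr_mono2) auto
    also have "\<dots> = 4 powr e * real M powr e" by (simp add: powr_mult)
    also have "\<dots> \<le> 4 * real M powr d"
      using M e powr_mono[of e 1 "4::real"] by (intro mult_mono powr_mono) auto
    also have "16 * (4 * real M powr d) * B = 64 * B * real M powr d" by simp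
    also have "\<dots> \<le> C * real M powr d" by (intro mult_right_mono) (auto simp: C_def)
    finally show ?thesis using B by (simp add: mult_left_mono mult_right_mono)
  qed
  moreover have "C \<ge> 1" by (simp add: C_def)
  ultimately show ?thesis by blast
qed

section \<open>Integration over the sphere and over time\<close>

lemma has_bochner_integral_lborel_prod_mult:
  fixes f g :: "real \<Rightarrow> real"
  assumes f: "integrable lborel f" and g: "integrable lborel g"
  shows "has_bochner_integral lborel (\<lambda>z. f (fst z) * g (snd z)) (integral\<^sup>L lborel f * integral\<^sup>L lborel g)"
proof -
  have [measurable]: "f \<in> borel_measurable borel" "g \<in> borel_measurable borel" using f g by auto
  have I: "integrable (lborel \<Otimes>\<^sub>M lborel) (\<lambda>z. f (fst z) * g (snd z))"
  proof (rule lborel_pair.Fubini_integrable)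
    show "integrable lborel (\<lambda>x. \<integral>y. norm (f (fst (x, y)) * g (snd (x, y))) \<partial>lborel)"
      using f by (simp add: abs_mult)
    show "AE x in lborel. integrable lborel (\<lambda>y. f (fst (x, y)) * g (snd (x, y)))"
      using g by simp
  qed measurable
  have "integral\<^sup>L (lborel \<Otimes>\<^sub>M lborel) (\<lambda>z. f (fst z) * g (snd z)) = integral\<^sup>L lborel f * integral\<^sup>L lborel g"
    using lborel_pair.integral_fst'[OF I] by simp
  with I show ?thesis by (simp add: has_bochner_integral_iff lborel_prod)
qed

lemma has_bochner_integral_indicator_Icc:
  fixes f F :: "real \<Rightarrow> 'a::euclidean_space"
  assumes "a \<le> b" "continuous_on {a..b} f"
    and "\<And>x. a \<le> x \<Longrightarrow> x \<le> b \<Longrightarrow> (F has_vector_derivative f x) (at x within {a..b})"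
  shows "has_bochner_integral lborel (\<lambda>x. indicator {a..b} x *\<^sub>R f x) (F b - F a)"
  using borel_integrable_atLeastAtMost'[OF assms(2)] integral_FTC_atLeastAtMost[OF assms(1,3,2)]
  by (simp add: has_bochner_integral_iff set_integrable_def)

lemma poly_antiderivative: "\<exists>q::real poly. pderiv q = p"
proof -
  define q where "q = (\<Sum>i\<le>degree p. monom (coeff p i / real (Suc i)) (Suc i))"
  have "pderiv q = (\<Sum>i\<le>degree p. monom (coeff p i) i)"
  proof -
    have "pderiv (sum f X) = (\<Sum>x\<in>X. pderiv (f x))" for f :: "nat \<Rightarrow> real poly" and X
      using higher_pderiv_sum[of 1 f X] by simp
    then show ?thesis unfolding q_def by (simp add: pderiv_monom del: of_nat_Suc)
  qed
  also have "\<dots> = p" by (rule poly_as_sum_of_monoms)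
  finally show ?thesis by blast
qed

text \<open>The substitution \<open>x = cos \<theta>\<close>, carried out with the antiderivative
  \<open>- q (cos \<theta>)\<close>, where \<open>q' = p\<close>.\<close>

lemma has_bochner_integral_poly_cos:
  "has_bochner_integral lborel (\<lambda>\<theta>. indicator {0..pi} \<theta> * (sin \<theta> * poly p (cos \<theta>))) (integral_poly p)"
proof -
  obtain q where q: "pderiv q = p" using poly_antiderivative by blast
  have "has_bochner_integral lborel (\<lambda>\<theta>. indicator {0..pi} \<theta> *\<^sub>R (sin \<theta> * poly p (cos \<theta>)))
      (- poly q (cos pi) - - poly q (cos 0))"
  proof (rule has_bochner_integral_indicator_Icc)
    fix \<theta> :: real
    have "((\<lambda>\<theta>. - poly q (cos \<theta>)) has_real_derivative sin \<theta> * poly p (cos \<theta>)) (at \<theta> within {0..pi})"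
      by (auto intro!: derivative_eq_intros DERIV_chain2[OF poly_DERIV] simp: q)
    then show "((\<lambda>\<theta>. - poly q (cos \<theta>)) has_vector_derivative sin \<theta> * poly p (cos \<theta>)) (at \<theta> within {0..pi})"
      by (simp add: has_real_derivative_iff_has_vector_derivative)
  qed (auto intro!: continuous_intros)
  also have "- poly q (cos pi) - - poly q (cos 0) = integral_poly p"
    using integral_poly_pderiv[of q] by (simp add: q)
  finally show ?thesis by simp
qed

lemma spherical_point_measurable [measurable]:
  "spherical_point \<in> measurable borel (restrict_space borel (sphere 0 1))"
proof (rule measurable_restrict_space2)
  show "spherical_point \<in> space borel \<rightarrow> sphere 0 1"
  proof
    fix z :: "real \<times> real"
    obtain \<theta> \<phi> where z: "z = (\<theta>, \<phi>)" by (cases z)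
    have "(sin \<theta> * cos \<phi>)\<^sup>2 + (sin \<theta> * sin \<phi>)\<^sup>2 + (cos \<theta>)\<^sup>2
        = (sin \<theta>)\<^sup>2 * ((cos \<phi>)\<^sup>2 + (sin \<phi>)\<^sup>2) + (cos \<theta>)\<^sup>2"
      by (simp only: power_mult_distrib distrib_left)
    also have "\<dots> = 1" by (simp only: sin_cos_squared_add2) simp
    finally show "spherical_point z \<in> sphere 0 1"
      by (simp add: z spherical_point_def norm_vec_def L2_set_def sum_3)
  qed
  show "spherical_point \<in> borel_measurable borel"
  proof (rule borel_measurable_euclidean_space[THEN iffD2], rule ballI)
    fix b :: "real ^ 3" assume "b \<in> Basis"
    then have "\<exists>i. b = axis i 1" unfolding Basis_vec_def by auto
    then obtain i where b: "b = axis i 1" by blast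
    have "\<forall>i. (\<lambda>z. spherical_point z $ i) \<in> borel_measurable borel"
      unfolding forall_3 spherical_point_def case_prod_unfold vector_3
      by (simp add: borel_measurable_continuous_onI continuous_intros)
    then have "(\<lambda>z. spherical_point z $ i) \<in> borel_measurable borel" by (rule spec)
    then show "(\<lambda>z. spherical_point z \<bullet> b) \<in> borel_measurable borel"
      unfolding b inner_axis by simp
  qed
qed

lemma space_sphere_measure: "space sphere_measure = sphere 0 1"
  by (simp add: sphere_measure_def space_restrict_space)

text \<open>Archimedes: area on the sphere projects to \<open>2 * pi\<close> times length on the
  axis. Sphere integrals of polynomials in the height thus become values of
  \<open>integral_poly\<close>.\<close>

lemma has_bochner_integral_sphere_poly:
  "has_bochner_integral sphere_measure (\<lambda>x. poly p (x $ 3)) (2 * pi * integral_poly p)"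
proof -
  define w where "w = (\<lambda>z::real \<times> real. indicator ({0..pi} \<times> {0..2 * pi}) z * sin (fst z) :: real)"
  have w [measurable]: "w \<in> borel_measurable borel"
    unfolding w_def
    by (intro borel_measurable_times borel_measurable_indicator borel_measurable_continuous_onI)
      (auto intro!: continuous_intros borel_closed closed_Times)
  \<comment> \<open>Needed because \<open>ennreal\<close> would cut off negative values of the
    density.\<close>
  have w0: "w z \<ge> 0" for z
    unfolding w_def by (auto simp: indicator_def sin_ge_zero split: prod.splits)
  have S: "sphere_measure = distr (density lborel (\<lambda>z. ennreal (w z))) (restrict_space borel (sphere 0 1)) spherical_point"
  proof -
    have "(\<lambda>(\<theta>, \<phi>). ennreal (indicator ({0..pi} \<times> {0..2 * pi}) (\<theta>, \<phi>) * sin \<theta>)) = (\<lambda>z. ennreal (w z))"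
      by (rule ext) (simp add: w_def case_prod_unfold)
    then show ?thesis unfolding sphere_measure_def by (simp only:)
  qed
  have P: "(\<lambda>x. poly p (x $ 3)) \<in> borel_measurable (restrict_space borel (sphere 0 1))"
    by (intro measurable_restrict_space1 borel_measurable_continuous_onI continuous_intros)
  have sp [measurable]: "spherical_point \<in> measurable lborel (restrict_space borel (sphere 0 1))"
    "spherical_point \<in> measurable (density lborel (\<lambda>z. ennreal (w z))) (restrict_space borel (sphere 0 1))"
    by simp_all
  have Q: "(\<lambda>z. poly p (spherical_point z $ 3)) \<in> borel_measurable lborel"
    using measurable_compose[OF sp(1) P] by simp
  have "has_bochner_integral lborel
      (\<lambda>z. (indicator {0..pi} (fst z) * (sin (fst z) * poly p (cos (fst z)))) * indicator {0..2 * pi} (snd z))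
      (integral_poly p * (2 * pi))"
    using has_bochner_integral_lborel_prod_mult[of "\<lambda>\<theta>. indicator {0..pi} \<theta> * (sin \<theta> * poly p (cos \<theta>))"
        "indicator {0..2 * pi}"] has_bochner_integral_poly_cos[of p]
    by (simp add: has_bochner_integral_iff)
  also have "(\<lambda>z. (indicator {0..pi} (fst z) * (sin (fst z) * poly p (cos (fst z)))) * indicator {0..2 * pi} (snd z))
      = (\<lambda>z. w z *\<^sub>R poly p (spherical_point z $ 3))"
    by (auto simp: w_def spherical_point_def indicator_def split: prod.splits)
  finally have I: "has_bochner_integral lborel (\<lambda>z. w z *\<^sub>R poly p (spherical_point z $ 3)) (integral_poly p * (2 * pi))" .
  show ?thesis
    unfolding has_bochner_integral_iff S integrable_distr_eq[OF sp(2) P] integral_distr[OF sp(2) P]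
    using I w0 integrable_density[OF Q, of w] integral_density[OF Q, of w]
    by (simp add: has_bochner_integral_iff)
qed

lemma finite_measure_sphere: "finite_measure sphere_measure"
proof
  have "integrable sphere_measure (\<lambda>x. 1::real)"
    using has_bochner_integral_sphere_poly[of 1] by (simp add: has_bochner_integral_iff)
  then show "emeasure sphere_measure (space sphere_measure) \<noteq> \<infinity>"
    by (simp add: integrable_iff_bounded)
qed

section \<open>Orthogonality in time\<close>

lemma has_bochner_integral_cis:
  fixes \<nu> :: int
  shows "has_bochner_integral (restrict_space lborel {0..2 * pi}) (\<lambda>t. cis (t * of_int \<nu>)) (if \<nu> = 0 then of_real (2 * pi) else 0)"
proof -
  have "has_bochner_integral lborel (\<lambda>t. indicator {0..2 * pi} t *\<^sub>R cis (t * of_int \<nu>)) (if \<nu> = 0 then of_real (2 * pi) else 0)"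
  proof (cases "\<nu> = 0")
    case True
    have "has_bochner_integral lborel (\<lambda>t. indicator {0..2 * pi} t *\<^sub>R (1::complex)) (of_real (2 * pi) - of_real 0)"
      by (rule has_bochner_integral_indicator_Icc) (auto intro!: derivative_eq_intros continuous_intros)
    then show ?thesis using True by simp
  next
    case False
    have "has_bochner_integral lborel (\<lambda>t. indicator {0..2 * pi} t *\<^sub>R cis (t * of_int \<nu>))
      (cis (2 * pi * of_int \<nu>) / (\<i> * of_int \<nu>) - cis (0 * of_int \<nu>) / (\<i> * of_int \<nu>))"
    proof (rule has_bochner_integral_indicator_Icc)
      fix t :: real
      have "((\<lambda>t. exp (of_real t * (\<i> * of_int \<nu>)) / (\<i> * of_int \<nu>)) has_vector_derivative exp (of_real t * (\<i> * of_int \<nu>)))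
          (at t within {0..2 * pi})"
        using False by (auto intro!: derivative_eq_intros has_vector_derivative_real_field simp: field_simps)
      then show "((\<lambda>t. cis (t * of_int \<nu>) / (\<i> * of_int \<nu>)) has_vector_derivative cis (t * of_int \<nu>)) (at t within {0..2 * pi})"
        by (simp add: cis_conv_exp mult_ac)
    qed (auto intro!: continuous_intros)
    also have "cis (2 * pi * of_int \<nu>) = 1"
      using cis_multiple_2pi[of "of_int \<nu>"] by simp
    finally show ?thesis using False by simp
  qed
  then show ?thesis by (subst has_bochner_integral_restrict_space) auto
qed

text \<open>Expanding the square leaves only pairs of equal frequency. Each product is split by
  \<open>2 * a * b \<le> a\<^sup>2 + b\<^sup>2\<close>, and by symmetry every
  \<open>(cmod (c i))\<^sup>2\<close> is then counted at most \<open>R\<close> times.\<close>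

lemma time_integral_bound:
  fixes c :: "'a \<Rightarrow> complex" and k :: "'a \<Rightarrow> int"
  assumes A: "finite A" and R: "\<And>i. i \<in> A \<Longrightarrow> real (card {j \<in> A. k j = k i}) \<le> R"
  shows "(\<integral>t. (cmod (\<Sum>i\<in>A. c i * cis (t * of_int (k i))))\<^sup>2 \<partial>restrict_space lborel {0..2 * pi})
    \<le> 2 * pi * R * (\<Sum>i\<in>A. (cmod (c i))\<^sup>2)"
proof -
  define T where "T = restrict_space lborel {0..2 * pi}"
  define V where "V = (\<Sum>i\<in>A. \<Sum>j\<in>A. c i * cnj (c j) * (if k i - k j = 0 then of_real (2 * pi) else 0))"
  have "has_bochner_integral T (\<lambda>t. \<Sum>i\<in>A. \<Sum>j\<in>A. c i * cnj (c j) * cis (t * of_int (k i - k j))) V"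
    unfolding V_def T_def
    by (intro has_bochner_integral_sum has_bochner_integral_mult_right has_bochner_integral_cis)
  then have "has_bochner_integral T (\<lambda>t. Re (\<Sum>i\<in>A. \<Sum>j\<in>A. c i * cnj (c j) * cis (t * of_int (k i - k j)))) (Re V)"
    by (rule has_bochner_integral_bounded_linear[OF bounded_linear_Re])
  moreover have "Re (\<Sum>i\<in>A. \<Sum>j\<in>A. c i * cnj (c j) * cis (t * of_int (k i - k j)))
      = (cmod (\<Sum>i\<in>A. c i * cis (t * of_int (k i))))\<^sup>2" for t
  proof -
    have "cis (t * of_int (k i - k j)) = cis (t * of_int (k i)) * cnj (cis (t * of_int (k j)))" for i j
      by (simp add: cis_cnj cis_mult algebra_simps)
    then have "(\<Sum>i\<in>A. \<Sum>j\<in>A. c i * cnj (c j) * cis (t * of_int (k i - k j)))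
        = (\<Sum>i\<in>A. c i * cis (t * of_int (k i))) * cnj (\<Sum>i\<in>A. c i * cis (t * of_int (k i)))"
      by (simp only: sum_product cnj_sum complex_cnj_mult) (simp add: mult_ac)
    also have "\<dots> = of_real ((cmod (\<Sum>i\<in>A. c i * cis (t * of_int (k i))))\<^sup>2)"
      by (simp only: complex_norm_square)
    finally show ?thesis by (simp only: Re_complex_of_real)
  qed
  ultimately have eq: "(\<integral>t. (cmod (\<Sum>i\<in>A. c i * cis (t * of_int (k i))))\<^sup>2 \<partial>T) = Re V"
    by (simp add: has_bochner_integral_iff)
  define E where "E = (\<lambda>i j. if k i = k j then 1 else 0 :: real)"
  have "Re V = (\<Sum>i\<in>A. \<Sum>j\<in>A. 2 * pi * (E i j * Re (c i * cnj (c j))))"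
    unfolding V_def E_def by (simp only: Re_sum) (intro sum.cong refl, simp)
  also have "\<dots> \<le> (\<Sum>i\<in>A. \<Sum>j\<in>A. 2 * pi * (E i j * (((cmod (c i))\<^sup>2 + (cmod (c j))\<^sup>2) / 2)))"
  proof (intro sum_mono mult_left_mono)
    fix i j
    have "Re (c i * cnj (c j)) \<le> cmod (c i) * cmod (c j)"
      using complex_Re_le_cmod[of "c i * cnj (c j)"] by (simp add: norm_mult)
    also have "\<dots> \<le> ((cmod (c i))\<^sup>2 + (cmod (c j))\<^sup>2) / 2"
      using zero_le_power2[of "cmod (c i) - cmod (c j)"] by (simp add: power2_diff)
    finally show "Re (c i * cnj (c j)) \<le> ((cmod (c i))\<^sup>2 + (cmod (c j))\<^sup>2) / 2" .
  qed (auto simp: E_def)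
  also have "\<dots> = (\<Sum>i\<in>A. \<Sum>j\<in>A. pi * (E i j * (cmod (c i))\<^sup>2) + pi * (E i j * (cmod (c j))\<^sup>2))"
    by (intro sum.cong refl) (simp add: field_simps)
  also have "\<dots> = pi * ((\<Sum>i\<in>A. \<Sum>j\<in>A. E i j * (cmod (c i))\<^sup>2) + (\<Sum>i\<in>A. \<Sum>j\<in>A. E i j * (cmod (c j))\<^sup>2))"
    by (simp only: sum.distrib sum_distrib_left distrib_left)
  also have "(\<Sum>i\<in>A. \<Sum>j\<in>A. E i j * (cmod (c j))\<^sup>2) = (\<Sum>i\<in>A. \<Sum>j\<in>A. E i j * (cmod (c i))\<^sup>2)"
    by (subst sum.swap) (intro sum.cong refl, auto simp: E_def)
  also have "pi * ((\<Sum>i\<in>A. \<Sum>j\<in>A. E i j * (cmod (c i))\<^sup>2) + (\<Sum>i\<in>A. \<Sum>j\<in>A. E i j * (cmod (c i))\<^sup>2))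
      = 2 * pi * (\<Sum>i\<in>A. (\<Sum>j\<in>A. E i j) * (cmod (c i))\<^sup>2)"
    by (simp add: sum_distrib_right)
  also have "\<dots> \<le> 2 * pi * (\<Sum>i\<in>A. R * (cmod (c i))\<^sup>2)"
  proof (intro mult_left_mono sum_mono mult_right_mono)
    fix i assume "i \<in> A"
    have "(\<Sum>j\<in>A. E i j) = real (card {j \<in> A. k j = k i})"
      unfolding E_def using A by (simp add: sum.If_cases Int_def eq_commute)
    then show "(\<Sum>j\<in>A. E i j) \<le> R" using R[OF \<open>i \<in> A\<close>] by simp
  qed auto
  finally show ?thesis unfolding T_def[symmetric] eq by (simp add: sum_distrib_left mult_ac)
qed

section \<open>The bilinear estimate\<close>

lemma sphere_coordinate_bound:
  fixes x :: "real ^ 'n"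
  assumes "x \<in> sphere 0 1"
  shows "\<bar>x $ i\<bar> \<le> 1"
  using component_le_norm_cart[of x i] assms by simp

lemma zonal_fun_LP_proj:
  assumes "x \<in> sphere 0 1"
  shows "zonal_fun (LP_proj N a) x = (\<Sum>n\<in>{N..<2 * N}. a n * of_real (poly (legendre_normalized n) (x $ 3)))"
proof -
  have "cos (polar_angle x) = x $ 3"
    unfolding polar_angle_def using sphere_coordinate_bound[OF assms, of 3] by (simp add: cos_arccos_abs)
  then have Y: "zonal_harmonic n (polar_angle x) = poly (legendre_normalized n) (x $ 3)" for n
    by (simp add: zonal_harmonic_def legendre_normalized_def)
  have "zonal_fun (LP_proj N a) x = (\<Sum>n\<in>{N..<2 * N}. LP_proj N a n * of_real (zonal_harmonic n (polar_angle x)))"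
    unfolding zonal_fun_def by (rule suminf_finite) (auto simp: LP_proj_def)
  then show ?thesis by (simp add: Y LP_proj_def)
qed

text \<open>Parseval: the constant is \<open>2 * pi\<close> from the longitude times 2 from
  \<open>legendre_normalized_orthonormal\<close>.\<close>

lemma L2_norm_zonal_fun_LP_proj:
  "(L2_norm sphere_measure (zonal_fun (LP_proj N a)))\<^sup>2 = 4 * pi * (\<Sum>n\<in>{N..<2 * N}. (cmod (a n))\<^sup>2)"
proof -
  \<comment> \<open>Polynomials here are real, so real and imaginary parts of the coefficients are
    treated separately.\<close>
  define p where "p = (\<lambda>r::nat \<Rightarrow> real. \<Sum>n\<in>{N..<2 * N}. smult (r n) (legendre_normalized n))"
  have p: "integral_poly ((p r)\<^sup>2) = 2 * (\<Sum>n\<in>{N..<2 * N}. (r n)\<^sup>2)" for r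
  proof -
    have "(p r)\<^sup>2 = (\<Sum>n\<in>{N..<2 * N}. \<Sum>m\<in>{N..<2 * N}. smult (r n * r m) (legendre_normalized n * legendre_normalized m))"
      unfolding p_def power2_eq_square sum_product
      by (intro sum.cong refl) (simp add: mult_ac)
    also have "integral_poly \<dots> = (\<Sum>n\<in>{N..<2 * N}. \<Sum>m\<in>{N..<2 * N}. if n = m then 2 * (r n * r m) else 0)"
      unfolding integral_poly_sum integral_poly_smult legendre_normalized_orthonormal
      by (intro sum.cong refl) auto
    also have "\<dots> = (\<Sum>n\<in>{N..<2 * N}. 2 * (r n)\<^sup>2)"
      by (intro sum.cong refl) (simp add: power2_eq_square)
    finally show ?thesis by (simp add: sum_distrib_left)
  qed
  have "(\<integral>x. (cmod (zonal_fun (LP_proj N a) x))\<^sup>2 \<partial>sphere_measure)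
      = (\<integral>x. poly ((p (\<lambda>n. Re (a n)))\<^sup>2 + (p (\<lambda>n. Im (a n)))\<^sup>2) (x $ 3) \<partial>sphere_measure)"
  proof (rule Bochner_Integration.integral_cong[OF refl])
    fix x assume "x \<in> space sphere_measure"
    then have "x \<in> sphere 0 1" by (simp only: space_sphere_measure)
    from zonal_fun_LP_proj[OF this]
    show "(cmod (zonal_fun (LP_proj N a) x))\<^sup>2 = poly ((p (\<lambda>n. Re (a n)))\<^sup>2 + (p (\<lambda>n. Im (a n)))\<^sup>2) (x $ 3)"
      by (simp add: cmod_power2 p_def poly_sum)
  qed
  also have "\<dots> = 2 * pi * (2 * (\<Sum>n\<in>{N..<2 * N}. (Re (a n))\<^sup>2) + 2 * (\<Sum>n\<in>{N..<2 * N}. (Im (a n))\<^sup>2))"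
    using has_bochner_integral_sphere_poly[of "(p (\<lambda>n. Re (a n)))\<^sup>2 + (p (\<lambda>n. Im (a n)))\<^sup>2"]
    unfolding integral_poly_add p by (simp only: has_bochner_integral_iff)
  also have "\<dots> = 4 * pi * (\<Sum>n\<in>{N..<2 * N}. (cmod (a n))\<^sup>2)"
    by (simp add: cmod_power2 sum.distrib algebra_simps)
  finally show ?thesis
    unfolding L2_norm_def by (simp add: sum_nonneg)
qed

lemma schroedinger_product:
  assumes "x \<in> sphere 0 1"
  shows "zonal_fun (LP_proj N (schroedinger t f)) x * zonal_fun (LP_proj M (schroedinger t g)) x
    = (\<Sum>(n, m)\<in>{N..<2 * N} \<times> {M..<2 * M}.
        (f n * g m * of_real (poly (legendre_normalized n) (x $ 3) * poly (legendre_normalized m) (x $ 3)))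
         * cis (t * of_int (- int (n * (n + 1) + m * (m + 1)))))"
proof -
  have "(schroedinger t f n * of_real u) * (schroedinger t g m * of_real v)
      = (f n * g m * of_real (u * v)) * cis (t * of_int (- int (n * (n + 1) + m * (m + 1))))" for n m u v
  proof -
    have "cis (t * of_int (- int (n * (n + 1) + m * (m + 1))))
        = cis (t * laplace_eigenvalue n) * cis (t * laplace_eigenvalue m)"
      unfolding cis_mult laplace_eigenvalue_def by (simp add: algebra_simps)
    then show ?thesis by (simp add: schroedinger_def cis_conv_exp mult_ac)
  qed
  then show ?thesis
    unfolding zonal_fun_LP_proj[OF assms] sum_product sum.cartesian_product
    by (intro sum.cong refl) auto
qed

text \<open>At each fixed point the time integral is bounded with coefficients depending on that
  point. The result is a polynomial in the height, whose sphere integral is estimated term by term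
  with \<open>J\<close>.\<close>

lemma L2_norm_schroedinger_product:
  assumes R: "\<And>k. real (card (resonances N M k)) \<le> R"
    and J: "\<And>n m. m < 2 * M \<Longrightarrow> integral_poly ((legendre_normalized n)\<^sup>2 * (legendre_normalized m)\<^sup>2) \<le> J"
    and nonneg: "R \<ge> 0" "J \<ge> 0"
  shows "(L2_norm (sphere_measure \<Otimes>\<^sub>M restrict_space lborel {0..2 * pi})
      (\<lambda>(x, t). zonal_fun (LP_proj N (schroedinger t f)) x * zonal_fun (LP_proj M (schroedinger t g)) x))\<^sup>2
    \<le> (2 * pi)\<^sup>2 * R * J * (\<Sum>n\<in>{N..<2 * N}. (cmod (f n))\<^sup>2) * (\<Sum>m\<in>{M..<2 * M}. (cmod (g m))\<^sup>2)"
    (is "(L2_norm (_ \<Otimes>\<^sub>M ?T) ?\<Phi>)\<^sup>2 \<le> ?B")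
proof -
  define A where "A = {N..<2 * N} \<times> {M..<2 * M}"
  define k where "k = (\<lambda>(n, m). - int (n * (n + 1) + m * (m + 1)))"
  have finA: "finite A" by (simp add: A_def)
  have fiber: "real (card {j \<in> A. k j = k i}) \<le> R" if "i \<in> A" for i
  proof -
    \<comment> \<open>The indices sharing a frequency form a set of resonances, counted by
      \<open>R\<close>.\<close>
    have "{j \<in> A. k j = k i} = resonances N M (fst i * (fst i + 1) + snd i * (snd i + 1))"
      by (auto simp: A_def k_def resonances_def split: prod.splits simp flip: of_nat_add of_nat_mult of_nat_Suc)
    then show ?thesis using R by simp
  qed
  have "finite_measure ?T"
    by (intro finite_measureI) (simp add: emeasure_restrict_space space_restrict_space)
  then interpret T: finite_measure ?T .
  interpret S: finite_measure sphere_measure by (rule finite_measure_sphere)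
  interpret ST: pair_sigma_finite sphere_measure ?T ..
  define q where "q = (\<Sum>(n, m)\<in>A. smult ((cmod (f n))\<^sup>2 * (cmod (g m))\<^sup>2)
      ((legendre_normalized n)\<^sup>2 * (legendre_normalized m)\<^sup>2))"
  have B: "?B \<ge> 0" using nonneg by (intro mult_nonneg_nonneg sum_nonneg) auto
  have "integral\<^sup>L (sphere_measure \<Otimes>\<^sub>M ?T) (\<lambda>z. (cmod (?\<Phi> z))\<^sup>2) \<le> ?B"
  proof (cases "integrable (sphere_measure \<Otimes>\<^sub>M ?T) (\<lambda>z. (cmod (?\<Phi> z))\<^sup>2)")
    \<comment> \<open>Here the integral has the default value 0.\<close>
    case False
    then show ?thesis using B by (simp add: not_integrable_integral_eq)
  next
    case True
    have "integral_poly q \<le> (\<Sum>(n, m)\<in>A. (cmod (f n))\<^sup>2 * (cmod (g m))\<^sup>2 * J)"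
      unfolding q_def integral_poly_sum
    proof (rule sum_mono)
      fix i assume "i \<in> A"
      then show "integral_poly (case i of (n, m) \<Rightarrow> smult ((cmod (f n))\<^sup>2 * (cmod (g m))\<^sup>2)
          ((legendre_normalized n)\<^sup>2 * (legendre_normalized m)\<^sup>2))
        \<le> (case i of (n, m) \<Rightarrow> (cmod (f n))\<^sup>2 * (cmod (g m))\<^sup>2 * J)"
        by (auto simp: A_def integral_poly_smult intro!: mult_left_mono J)
    qed
    also have "\<dots> = J * ((\<Sum>n\<in>{N..<2 * N}. (cmod (f n))\<^sup>2) * (\<Sum>m\<in>{M..<2 * M}. (cmod (g m))\<^sup>2))"
      unfolding A_def sum_product sum.cartesian_product by (simp add: sum_distrib_left case_prod_beta mult_ac)
    finally have q: "integral_poly q \<le> J * ((\<Sum>n\<in>{N..<2 * N}. (cmod (f n))\<^sup>2) * (\<Sum>m\<in>{M..<2 * M}. (cmod (g m))\<^sup>2))" .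
    have "integral\<^sup>L (sphere_measure \<Otimes>\<^sub>M ?T) (\<lambda>z. (cmod (?\<Phi> z))\<^sup>2)
        = (\<integral>x. (\<integral>t. (cmod (?\<Phi> (x, t)))\<^sup>2 \<partial>?T) \<partial>sphere_measure)"
      by (rule ST.integral_fst'[OF True, symmetric])
    also have "\<dots> \<le> (\<integral>x. poly (smult (2 * pi * R) q) (x $ 3) \<partial>sphere_measure)"
    proof (rule integral_mono)
      show "integrable sphere_measure (\<lambda>x. \<integral>t. (cmod (?\<Phi> (x, t)))\<^sup>2 \<partial>?T)"
        by (rule ST.integrable_fst'[OF True])
      show "integrable sphere_measure (\<lambda>x. poly (smult (2 * pi * R) q) (x $ 3))"
        using has_bochner_integral_sphere_poly by (simp only: has_bochner_integral_iff)
      fix x assume "x \<in> space sphere_measure"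
      then have x: "x \<in> sphere 0 1" by (simp only: space_sphere_measure)
      define c where "c = (\<lambda>(n, m). f n * g m * of_real (poly (legendre_normalized n) (x $ 3) * poly (legendre_normalized m) (x $ 3)))"
      have "?\<Phi> (x, t) = (\<Sum>i\<in>A. c i * cis (t * of_int (k i)))" for t
        using schroedinger_product[OF x, of N t f M g]
        unfolding A_def c_def k_def by (simp only: case_prod_unfold fst_conv snd_conv)
      then have "(\<integral>t. (cmod (?\<Phi> (x, t)))\<^sup>2 \<partial>?T) = (\<integral>t. (cmod (\<Sum>i\<in>A. c i * cis (t * of_int (k i))))\<^sup>2 \<partial>?T)"
        by (simp only:)
      also have "\<dots> \<le> 2 * pi * R * (\<Sum>i\<in>A. (cmod (c i))\<^sup>2)"
        by (rule time_integral_bound[OF finA fiber])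
      also have "(\<Sum>i\<in>A. (cmod (c i))\<^sup>2) = poly q (x $ 3)"
        unfolding q_def poly_sum c_def
        by (intro sum.cong refl) (auto simp: norm_mult power_mult_distrib)
      finally show "(\<integral>t. (cmod (?\<Phi> (x, t)))\<^sup>2 \<partial>?T) \<le> poly (smult (2 * pi * R) q) (x $ 3)" by simp
    qed
    also have "\<dots> = 2 * pi * (2 * pi * R * integral_poly q)"
      using has_bochner_integral_sphere_poly[of "smult (2 * pi * R) q"]
      by (simp only: has_bochner_integral_iff integral_poly_smult)
    also have "\<dots> \<le> 2 * pi * (2 * pi * R * (J * ((\<Sum>n\<in>{N..<2 * N}. (cmod (f n))\<^sup>2) * (\<Sum>m\<in>{M..<2 * M}. (cmod (g m))\<^sup>2))))"
      using q nonneg by (intro mult_left_mono) auto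
    also have "\<dots> = ?B" by (simp add: power2_eq_square)
    finally show ?thesis .
  qed
  then show ?thesis unfolding L2_norm_def by simp
qed

theorem lemma5p1:
  fixes \<epsilon> :: real
  assumes "\<epsilon> > 0"
  shows "\<exists>C>0. \<forall>(s::real) f g (N::nat) (M::nat).
    f \<in> zonal_sobolev s \<longrightarrow> g \<in> zonal_sobolev s \<longrightarrow>
    dyadic N \<longrightarrow> dyadic M \<longrightarrow> N \<ge> M \<longrightarrow> M \<ge> 1 \<longrightarrow>
    L2_norm (sphere_measure \<Otimes>\<^sub>M restrict_space lborel {0..2 * pi})
      (\<lambda>(x, t). zonal_fun (LP_proj N (schroedinger t f)) x * zonal_fun (LP_proj M (schroedinger t g)) x)
    \<le> C * real M powr \<epsilon>
        * L2_norm sphere_measure (zonal_fun (LP_proj N f))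
        * L2_norm sphere_measure (zonal_fun (LP_proj M g))"
proof -
  obtain C1 where C1: "C1 \<ge> 1"
    "\<And>N M k. 1 \<le> M \<Longrightarrow> M \<le> N \<Longrightarrow> real (card (resonances N M k)) \<le> C1 * real M powr \<epsilon>"
    using card_resonances_bound[OF assms] by blast
  obtain C2 where C2: "C2 \<ge> 1"
    "\<And>n m M. M \<ge> 1 \<Longrightarrow> m < 2 * M \<Longrightarrow>
      integral_poly ((legendre_normalized n)\<^sup>2 * (legendre_normalized m)\<^sup>2) \<le> C2 * real M powr \<epsilon>"
    using integral_legendre_product_bound[OF assms] by blast
  \<comment> \<open>The estimate is proved for squared norms, where each of the two bounds
    contributes a factor \<open>M powr \<epsilon>\<close>; the root leaves one such factor.\<close>
  define C where "C = sqrt (C1 * C2)"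
  have "L2_norm (sphere_measure \<Otimes>\<^sub>M restrict_space lborel {0..2 * pi})
      (\<lambda>(x, t). zonal_fun (LP_proj N (schroedinger t f)) x * zonal_fun (LP_proj M (schroedinger t g)) x)
    \<le> C * real M powr \<epsilon>
        * L2_norm sphere_measure (zonal_fun (LP_proj N f))
        * L2_norm sphere_measure (zonal_fun (LP_proj M g))" (is "?L \<le> _ * ?F * ?G")
    if M: "M \<le> N" "1 \<le> M" for f g N M
  proof (rule power2_le_imp_le)
    define F where "F = (\<Sum>n\<in>{N..<2 * N}. (cmod (f n))\<^sup>2)"
    define G where "G = (\<Sum>n\<in>{M..<2 * M}. (cmod (g n))\<^sup>2)"
    have FG: "F \<ge> 0" "G \<ge> 0" by (auto simp: F_def G_def intro: sum_nonneg)
    have "?L\<^sup>2 \<le> (2 * pi)\<^sup>2 * (C1 * real M powr \<epsilon>) * (C2 * real M powr \<epsilon>) * F * G"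
      unfolding F_def G_def using M C1 C2 by (intro L2_norm_schroedinger_product) auto
    also have "\<dots> = C1 * C2 * (real M powr \<epsilon>)\<^sup>2 * F * G * (2 * pi)\<^sup>2"
      by (simp add: power2_eq_square mult_ac)
    \<comment> \<open>The squared norms on the right supply a factor \<open>4 * pi\<close> each,
      more than the \<open>(2 * pi)\<^sup>2\<close> required.\<close>
    also have "\<dots> \<le> C1 * C2 * (real M powr \<epsilon>)\<^sup>2 * F * G * (4 * pi)\<^sup>2"
      using C1(1) C2(1) FG by (intro mult_left_mono power_mono mult_nonneg_nonneg) auto
    also have "\<dots> = (C * real M powr \<epsilon> * ?F * ?G)\<^sup>2"
      using C1(1) C2(1) by (simp add: power_mult_distrib L2_norm_zonal_fun_LP_proj F_def G_def C_def)
        (simp add: power2_eq_square)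
    finally show "?L\<^sup>2 \<le> (C * real M powr \<epsilon> * ?F * ?G)\<^sup>2" .
    show "0 \<le> C * real M powr \<epsilon> * ?F * ?G"
      using C1(1) C2(1) by (auto simp: C_def L2_norm_def)
  qed
  moreover have "C > 0" using C1(1) C2(1) by (simp add: C_def)
  ultimately show ?thesis by blast
qed

end
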